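(* Let $f\in L^1(\mathbb R)$. Suppose that $P(M=0)=1$ and $$0<\int_\Omega\log|L(\omega)|\,P(d\omega)<+\infty.$$ Then $f\in V_g$ if and only if $$\widehat{f}(x)=\widehat{f}(0)+\sum_{n=1}^\infty I_{g,n}(x)+\widehat{g}(x)$$ for every $x\in\mathbb R$.
   Context: Let $(\Omega,\mathcal A,P)$ be a complete probability space, $L,M\colon\Omega\to\mathbb R$ random variables with $P(L=0)=0$, and $g\in L^1(\mathbb R)$ a nontrivial (nonzero) function. $V_g$ denotes the set of all $f\in L^1(\mathbb R)$ such that $$f(x)=\int_{\Omega}|L(\omega)|f(L(\omega)x-M(\omega))\,P(d\omega)+g(x)$$ for Lebesgue-almost all $x\in\mathbb R$ (this does not depend on the representative of $f$). The Fourier transform of $h\in L^1(\mathbb R)$ is $\widehat h(x)=\int_{\mathbb R}\exp\{itx\}h(t)\,dt$. $(\Omega^\infty,P^\infty)$ is the countable product of copies of $(\Omega,\mathcal A,P)$; for $n\in\mathbb N=\{1,2,\dots\}$ and $\varpi=(\omega_1,\omega_2,\dots)\in\Omega^\infty$ put $L_n(\varpi)=L(\omega_n)$ and $M_n(\varpi)=M(\omega_n)$. For $h\in L^1(\mathbb R)$, $n\in\mathbb N$ and $x\in\mathbb R$, $$I_{h,n}(x)=\int_{\Omega^\infty}\exp\left\{ix\sum_{k=1}^n\frac{M_k(\varpi)}{L_1(\varpi)\cdots L_k(\varpi)}\right\}\widehat{h}\left(\frac{x}{L_1(\varpi)\cdots L_n(\varpi)}\right)P^\infty(d\varpi).$$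 *)

theory Defs
  imports "HOL-Probability.Probability"
begin

text \<open>
  Elements of \<open>L\<^sup>1(\<real>)\<close> are represented by Lebesgue-integrable functions \<open>real \<Rightarrow> complex\<close>, that is,
  by arbitrary Lebesgue-measurable representatives; equality in \<open>L\<^sup>1\<close> is equality almost everywhere.
  The real-valued case is the one where the functions have values in the reals.
\<close>

definition L1 :: "(real \<Rightarrow> complex) set" where
  "L1 = {h. integrable lebesgue h}"

text \<open>
  If \<open>P\<close> is complete and \<open>P (L = 0) = 0\<close>, then for \<open>f \<in> L1\<close> the inner integrand is
  \<open>P\<close>-integrable for almost every \<open>x\<close> (Tonelli and the substitution \<open>y = L \<omega> * x - M \<omega>\<close>), so the
  convention that the integral of a non-integrable function is \<open>0\<close> plays no role here.
\<close>

definition V ::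
  "'a measure \<Rightarrow> ('a \<Rightarrow> real) \<Rightarrow> ('a \<Rightarrow> real) \<Rightarrow> (real \<Rightarrow> complex) \<Rightarrow> (real \<Rightarrow> complex) set" where
  "V P L M g =
    {f \<in> L1. AE x in lebesgue.
       f x = (\<integral>\<omega>. of_real \<bar>L \<omega>\<bar> * f (L \<omega> * x - M \<omega>) \<partial>P) + g x}"

definition fourier :: "(real \<Rightarrow> complex) \<Rightarrow> real \<Rightarrow> complex" where
  "fourier h x = (\<integral>t. exp (\<i> * of_real t * of_real x) * h t \<partial>lebesgue)"

definition countable_power :: "'a measure \<Rightarrow> (nat \<Rightarrow> 'a) measure" where
  "countable_power P = Pi\<^sub>M UNIV (\<lambda>_. P)"

text \<open>
  A point \<open>(\<omega>\<^sub>1, \<omega>\<^sub>2, \<dots>)\<close> of the infinite product is the function \<open>w\<close> with \<open>w 0 = \<omega>\<^sub>1\<close>,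
  \<open>w 1 = \<omega>\<^sub>2\<close>, and so on. Hence for \<open>n \<ge> 1\<close> the variable \<open>coord X n\<close> is \<open>X\<^sub>n\<close>, \<open>X\<^sub>n(w) = X(\<omega>\<^sub>n)\<close>.
\<close>

definition coord :: "('a \<Rightarrow> real) \<Rightarrow> nat \<Rightarrow> (nat \<Rightarrow> 'a) \<Rightarrow> real" where
  "coord X n w = X (w (n - 1))"

definition I_int ::
  "'a measure \<Rightarrow> ('a \<Rightarrow> real) \<Rightarrow> ('a \<Rightarrow> real) \<Rightarrow> (real \<Rightarrow> complex) \<Rightarrow> nat \<Rightarrow> real \<Rightarrow> complex" where
  "I_int P L M h n x =
    (\<integral>w. exp (\<i> * of_real x *
              of_real (\<Sum>k=1..n. coord M k w / (\<Prod>j=1..k. coord L j w))) *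
          fourier h (x / (\<Prod>j=1..n. coord L j w)) \<partial>countable_power P)"

end

theory Submission
  imports Defs
begin

text \<open>
  Write \<open>U \<phi> x = E (\<phi> (x / L))\<close>. Because \<open>M = 0\<close> almost surely, the integral of index \<open>n\<close> in the series is
  \<open>U\<^sup>n\<close> applied to the Fourier transform of \<open>g\<close>, and on the Fourier side the functional equation for
  \<open>f\<close> becomes \<open>\<phi> = U \<phi> + \<gamma>\<close>, with \<open>\<phi>\<close> and \<open>\<gamma>\<close> the transforms of \<open>f\<close> and \<open>g\<close>
  (\<open>I_int_eq_mavg_pow\<close>, \<open>V_iff_fourier\<close>). So the claim is that this equation is equivalent to
  \<open>\<Sum>\<^sub>n U\<^sup>n \<gamma> = \<phi> - \<phi> 0\<close>, the sum starting at \<open>n = 0\<close> and converging pointwise.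

  From the equation, \<open>\<Sum>\<^sub>n\<^sub><\<^sub>N U\<^sup>n \<gamma> = \<phi> - U\<^sup>N \<phi>\<close>, and \<open>U\<^sup>N \<phi> x\<close> tends to \<open>\<phi> 0\<close>: the mean of \<open>ln \<bar>L\<bar>\<close> is
  positive, so the products \<open>\<bar>L\<^sub>1 \<cdots> L\<^sub>N\<bar>\<close> tend to infinity in probability (\<open>mavg_pow_tendsto\<close>).

  Conversely, if the series has the stated sum, then \<open>\<psi> = \<phi> - U \<phi> - \<gamma>\<close> is bounded and satisfies
  \<open>\<Sum>\<^sub>n U\<^sup>n \<psi> = 0\<close> pointwise. Applying \<open>U\<close> to this identity term by term would give \<open>\<psi> = 0\<close>, but the
  partial sums are only known to tend to zero at each point, without a common integrable bound over
  the steps from a given point. The way around is \<open>potential_zero_imp_zero\<close>. Let \<open>W = (I + U) / 2\<close>, the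
  average over a lazy step. The sums \<open>S\<^sub>N = \<Sum>\<^sub>n\<^sub><\<^sub>N W\<^sup>n \<psi>\<close> tend to zero pointwise as well, because Euler
  summation keeps the sum of a convergent series. A lazy walk smooths: counting the variance that it
  accumulates shows that one difference \<open>\<theta> x - \<theta> (x * y)\<close> of \<open>\<theta> = W\<^sup>n \<psi>\<close> has mean square \<open>O(1/n)\<close> over
  \<open>y\<close>, so a triple difference in three independent directions has mean square \<open>O(1/n\<^sup>3)\<close>
  (\<open>lazy_smoothing\<close>, \<open>scale_diff3_lazy_pow\<close>). Therefore the triple differences of \<open>S\<^sub>N\<close> are
  bounded in \<open>L\<^sup>2\<close> uniformly in \<open>N\<close>. This replaces the missing domination: as they tend to zero
  pointwise, their means \<open>(I - U)\<^sup>3 S\<^sub>N\<close> tend to zero. On the other hand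
  \<open>(I - U)\<^sup>3 S\<^sub>N = 2 (I - U)\<^sup>2 (\<psi> - W\<^sup>N \<psi>)\<close>, which tends to \<open>2 (I - U)\<^sup>2 \<psi>\<close>. So \<open>(I - U)\<^sup>2 \<psi> = 0\<close>. A function
  that \<open>U\<close> fixes and whose iterates under \<open>U\<close> tend to zero vanishes; two uses of this remark give
  \<open>\<psi> = 0\<close>, and injectivity of the Fourier transform turns that into the functional equation.
\<close>

section \<open>Averages over multiplicative steps and lazy smoothing\<close>

text \<open>
  For \<open>\<mu>\<close> the law of \<open>1 / L\<close> this is the operator \<open>U\<close> above, and \<open>lazy\<close> is \<open>W\<close>.
\<close>

definition mavg :: "real measure \<Rightarrow> (real \<Rightarrow> 'b::{banach, second_countable_topology}) \<Rightarrow> real \<Rightarrow> 'b" where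
  "mavg \<mu> \<phi> x = (\<integral>y. \<phi> (x * y) \<partial>\<mu>)"

text \<open>
  One step of the walk that stays where it is with probability 1/2. Iterating this average smooths a
  function along every direction of the step law. Iterating \<open>mavg\<close> need not: if the step is
  deterministic, it only shifts.
\<close>

definition lazy :: "real measure \<Rightarrow> (real \<Rightarrow> 'b::{banach, second_countable_topology}) \<Rightarrow> real \<Rightarrow> 'b" where
  "lazy \<mu> \<phi> x = (1/2) *\<^sub>R (\<phi> x + mavg \<mu> \<phi> x)"

definition bounded_borel :: "(real \<Rightarrow> 'b::{banach, second_countable_topology}) \<Rightarrow> bool" where
  "bounded_borel \<phi> \<longleftrightarrow> \<phi> \<in> borel_measurable borel \<and> (\<exists>C. \<forall>x. norm (\<phi> x) \<le> C)"

definition bounded_family :: "'z measure \<Rightarrow> ('z \<Rightarrow> real \<Rightarrow> 'b::{banach, second_countable_topology}) \<Rightarrow> bool" where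
  "bounded_family N \<phi> \<longleftrightarrow> (\<lambda>(z, x). \<phi> z x) \<in> borel_measurable (N \<Otimes>\<^sub>M borel) \<and> (\<exists>C. \<forall>z x. norm (\<phi> z x) \<le> C)"

lemma bounded_borel_measurable [measurable_dest]: "bounded_borel \<phi> \<Longrightarrow> \<phi> \<in> borel_measurable borel"
  by (simp add: bounded_borel_def)

lemma bounded_family_joint_measurable: "bounded_family N \<phi> \<Longrightarrow> (\<lambda>(z, x). \<phi> z x) \<in> borel_measurable (N \<Otimes>\<^sub>M borel)"
  by (simp add: bounded_family_def)

lemma bounded_family_measurable:
  assumes "bounded_family N \<phi>" "g \<in> measurable K N" "h \<in> measurable K borel"
  shows "(\<lambda>k. \<phi> (g k) (h k)) \<in> borel_measurable K"
  using measurable_compose[OF measurable_Pair[OF assms(2,3)] bounded_family_joint_measurable[OF assms(1)]] by simp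

lemma bounded_family_bounded_borel: "bounded_family N \<phi> \<Longrightarrow> z \<in> space N \<Longrightarrow> bounded_borel (\<phi> z)"
  unfolding bounded_borel_def
  by (intro conjI bounded_family_measurable[of N \<phi> "\<lambda>_. z" _ "\<lambda>x. x"]) (auto simp: bounded_family_def)

lemma bounded_borel_norm2: "bounded_borel \<phi> \<Longrightarrow> bounded_borel (\<lambda>x. (norm (\<phi> x))\<^sup>2)"
proof -
  assume b: "bounded_borel \<phi>"
  then obtain C where C: "\<And>x. norm (\<phi> x) \<le> C" unfolding bounded_borel_def by auto
  have "\<forall>x. norm ((norm (\<phi> x))\<^sup>2) \<le> C\<^sup>2" using C by (auto intro!: power_mono)
  then show ?thesis using b unfolding bounded_borel_def by auto
qed

lemma bounded_borel_diff: "bounded_borel \<phi> \<Longrightarrow> bounded_borel \<psi> \<Longrightarrow> bounded_borel (\<lambda>x. \<phi> x - \<psi> x)"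
proof -
  assume b: "bounded_borel \<phi>" "bounded_borel \<psi>"
  then obtain C D where C: "\<And>x. norm (\<phi> x) \<le> C" "\<And>x. norm (\<psi> x) \<le> D" unfolding bounded_borel_def by auto
  have "\<forall>x. norm (\<phi> x - \<psi> x) \<le> C + D" using C by (meson add_mono norm_triangle_ineq4 order_trans)
  then show ?thesis using b unfolding bounded_borel_def by auto
qed

lemma bounded_borel_const: "bounded_borel (\<lambda>x. c)"
  unfolding bounded_borel_def by auto

lemma bounded_borel_scale: "bounded_borel \<phi> \<Longrightarrow> bounded_borel (\<lambda>x. \<phi> (x * y))"
  unfolding bounded_borel_def by auto

lemma bounded_family_norm2: "bounded_family N \<phi> \<Longrightarrow> bounded_family N (\<lambda>z x. (norm (\<phi> z x))\<^sup>2)"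
proof -
  assume b: "bounded_family N \<phi>"
  then obtain C where C: "\<And>z x. norm (\<phi> z x) \<le> C" unfolding bounded_family_def by auto
  have "\<forall>z x. norm ((norm (\<phi> z x))\<^sup>2) \<le> C\<^sup>2" using C by (auto intro!: power_mono)
  moreover have "(\<lambda>p. (norm ((\<lambda>(z, x). \<phi> z x) p))\<^sup>2) \<in> borel_measurable (N \<Otimes>\<^sub>M borel)"
    using bounded_family_joint_measurable[OF b] by measurable
  ultimately show ?thesis unfolding bounded_family_def by (auto simp: case_prod_beta)
qed

lemma bounded_borel_bounded_family: "bounded_borel \<phi> \<Longrightarrow> bounded_family N (\<lambda>z. \<phi>)"
  unfolding bounded_borel_def bounded_family_def by auto

context real_distribution
begin

lemma prob_UNIV [simp]: "prob UNIV = 1"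
  using prob_space by simp

lemma integrable_bounded:
  fixes f :: "real \<Rightarrow> 'b::{banach, second_countable_topology}"
  assumes "bounded_borel f" shows "integrable M f"
  using assms unfolding bounded_borel_def by (auto intro!: integrable_const_bound)

lemma integrable_bounded_borel:
  fixes f :: "real \<Rightarrow> 'b::{banach, second_countable_topology}"
  assumes "bounded_borel f" shows "integrable M (\<lambda>y. f (x * y))"
  by (rule integrable_bounded) (use assms in \<open>auto simp: bounded_borel_def\<close>)

lemma norm_integral_le_bound:
  fixes f :: "real \<Rightarrow> 'b::{banach, second_countable_topology}"
  assumes "bounded_borel f" "\<And>x. norm (f x) \<le> C" shows "norm (\<integral>y. f (x * y) \<partial>M) \<le> C"
proof -
  have "norm (\<integral>y. f (x * y) \<partial>M) \<le> (\<integral>y. norm (f (x * y)) \<partial>M)" by simp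
  also have "\<dots> \<le> (\<integral>y. C \<partial>M)"
    using assms(2) by (intro integral_mono integrable_norm integrable_bounded_borel[OF assms(1)]) auto
  finally show ?thesis by simp
qed

lemma mavg_norm_le:
  assumes "bounded_borel \<phi>" "\<And>x. norm (\<phi> x) \<le> C" shows "norm (mavg M \<phi> x) \<le> C"
  unfolding mavg_def using assms by (rule norm_integral_le_bound)

lemma bounded_family_mavg:
  assumes "bounded_family N \<phi>" shows "bounded_family N (\<lambda>z. mavg M (\<phi> z))"
proof -
  from assms obtain C where C: "\<And>z x. norm (\<phi> z x) \<le> C" unfolding bounded_family_def by auto
  have C0: "C \<ge> 0" using C[of undefined undefined] norm_ge_zero order_trans by blast
  have m: "(\<lambda>(q, y). \<phi> (fst q) (snd q * y)) \<in> borel_measurable ((N \<Otimes>\<^sub>M borel) \<Otimes>\<^sub>M M)"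
    unfolding case_prod_beta by (rule bounded_family_measurable[OF assms]) measurable
  have "(\<lambda>q. \<integral>y. \<phi> (fst q) (snd q * y) \<partial>M) \<in> borel_measurable (N \<Otimes>\<^sub>M borel)"
    using borel_measurable_lebesgue_integral[OF m] by simp
  moreover have "norm (mavg M (\<phi> z) x) \<le> C" for z x
  proof (cases "integrable M (\<lambda>y. \<phi> z (x * y))")
    case True
    have "norm (\<integral>y. \<phi> z (x * y) \<partial>M) \<le> (\<integral>y. norm (\<phi> z (x * y)) \<partial>M)" by simp
    also have "\<dots> \<le> (\<integral>y. C \<partial>M)"
      using C True by (intro integral_mono integrable_norm) auto
    finally show ?thesis by (simp add: mavg_def)
  qed (simp add: mavg_def not_integrable_integral_eq C0)
  ultimately show ?thesis unfolding bounded_family_def mavg_def case_prod_beta by blast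
qed

lemma bounded_family_lazy:
  assumes "bounded_family N \<phi>" shows "bounded_family N (\<lambda>z. lazy M (\<phi> z))"
proof -
  note f = bounded_family_mavg[OF assms]
  obtain C D where "\<And>z x. norm (\<phi> z x) \<le> C" "\<And>z x. norm (mavg M (\<phi> z) x) \<le> D"
    using f assms unfolding bounded_family_def by auto
  then have "norm (\<phi> z x + mavg M (\<phi> z) x) \<le> C + D" for z x
    by (intro order_trans[OF norm_triangle_ineq] add_mono)
  then have "\<forall>z x. norm (lazy M (\<phi> z) x) \<le> (C + D) / 2"
    unfolding lazy_def norm_scaleR by simp
  moreover have "(\<lambda>p. (1/2) *\<^sub>R ((\<lambda>(z, x). \<phi> z x) p + (\<lambda>(z, x). mavg M (\<phi> z) x) p)) \<in> borel_measurable (N \<Otimes>\<^sub>M borel)"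
    using bounded_family_joint_measurable[OF f] bounded_family_joint_measurable[OF assms] by measurable
  ultimately show ?thesis unfolding bounded_family_def lazy_def case_prod_beta by blast
qed

lemma bounded_borel_mavg: "bounded_borel \<phi> \<Longrightarrow> bounded_borel (mavg M \<phi>)"
  using bounded_family_bounded_borel[OF bounded_family_mavg[OF bounded_borel_bounded_family[of \<phi> M]]] by auto

lemma bounded_borel_lazy: "bounded_borel \<phi> \<Longrightarrow> bounded_borel (lazy M \<phi>)"
  using bounded_family_bounded_borel[OF bounded_family_lazy[OF bounded_borel_bounded_family[of \<phi> M]]] by auto

lemma bounded_borel_lazy_pow: "bounded_borel \<phi> \<Longrightarrow> bounded_borel ((lazy M ^^ n) \<phi>)"
  by (induction n) (auto intro: bounded_borel_lazy)

lemma bounded_borel_mavg_pow: "bounded_borel \<phi> \<Longrightarrow> bounded_borel ((mavg M ^^ n) \<phi>)"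
  by (induction n) (auto intro: bounded_borel_mavg)

lemma bounded_family_lazy_pow: "bounded_family N \<phi> \<Longrightarrow> bounded_family N (\<lambda>z. (lazy M ^^ n) (\<phi> z))"
  by (induction n) (auto intro: bounded_family_lazy)

lemma mavg_diff:
  assumes "bounded_borel \<phi>" "bounded_borel \<psi>"
  shows "mavg M (\<lambda>x. \<phi> x - \<psi> x) = (\<lambda>x. mavg M \<phi> x - mavg M \<psi> x)"
  unfolding mavg_def by (intro ext Bochner_Integration.integral_diff integrable_bounded_borel assms)

lemma lazy_diff:
  assumes "bounded_borel \<phi>" "bounded_borel \<psi>"
  shows "lazy M (\<lambda>x. \<phi> x - \<psi> x) = (\<lambda>x. lazy M \<phi> x - lazy M \<psi> x)"
  unfolding lazy_def mavg_diff[OF assms] by (auto simp: algebra_simps)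

lemma lazy_scale: "lazy M (\<lambda>z. \<phi> (z * y)) = (\<lambda>x. lazy M \<phi> (x * y))"
  unfolding lazy_def mavg_def by (simp add: mult_ac)

lemma mavg_pow_diff:
  assumes "bounded_borel \<phi>" "bounded_borel \<psi>"
  shows "(mavg M ^^ n) (\<lambda>x. \<phi> x - \<psi> x) = (\<lambda>x. (mavg M ^^ n) \<phi> x - (mavg M ^^ n) \<psi> x)"
  by (induction n) (simp_all add: mavg_diff bounded_borel_mavg_pow assms)

lemma lazy_mono:
  fixes \<phi> \<psi> :: "real \<Rightarrow> real"
  assumes "bounded_borel \<phi>" "bounded_borel \<psi>" "\<And>x. \<phi> x \<le> \<psi> x"
  shows "lazy M \<phi> x \<le> lazy M \<psi> x"
proof -
  have "mavg M \<phi> x \<le> mavg M \<psi> x"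
    unfolding mavg_def using assms by (intro integral_mono integrable_bounded_borel) auto
  then show ?thesis using assms(3)[of x] by (simp add: lazy_def)
qed

text \<open>
  The variance of \<open>\<phi>\<close> after one lazy step is at least a quarter of the mean squared increment of \<open>\<phi>\<close>
  along a step, because half of the mass stays at \<open>x\<close>.
\<close>

lemma lazy_variance:
  fixes \<phi> :: "real \<Rightarrow> complex"
  assumes "bounded_borel \<phi>"
  shows "(1/4) * (\<integral>y. (norm (\<phi> x - \<phi> (x * y)))\<^sup>2 \<partial>M) + (norm (lazy M \<phi> x))\<^sup>2
    \<le> lazy M (\<lambda>z. (norm (\<phi> z))\<^sup>2) x"
proof -
  define a m S where "a = \<phi> x" and "m = mavg M \<phi> x" and "S = mavg M (\<lambda>z. (norm (\<phi> z))\<^sup>2) x"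
  have expand: "(\<integral>y. (norm (b - \<phi> (x * y)))\<^sup>2 \<partial>M) = (norm b)\<^sup>2 - 2 * (b \<bullet> m) + S" for b
  proof -
    have i1: "integrable M (\<lambda>y. (norm (\<phi> (x * y)))\<^sup>2)"
      using integrable_bounded_borel[OF bounded_borel_norm2[OF assms]] .
    have i2: "integrable M (\<lambda>y. \<phi> (x * y))" using integrable_bounded_borel[OF assms] .
    have "(\<integral>y. (norm (b - \<phi> (x * y)))\<^sup>2 \<partial>M)
        = (\<integral>y. (norm b)\<^sup>2 - 2 * (b \<bullet> \<phi> (x * y)) + (norm (\<phi> (x * y)))\<^sup>2 \<partial>M)"
      by (intro Bochner_Integration.integral_cong refl)
         (simp add: power2_norm_eq_inner inner_diff_left inner_diff_right inner_commute)
    also have "\<dots> = (norm b)\<^sup>2 - 2 * (b \<bullet> (\<integral>y. \<phi> (x * y) \<partial>M)) + S"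
      using i1 i2 by (simp add: S_def mavg_def)
    finally show ?thesis by (simp add: m_def mavg_def)
  qed
  have "0 \<le> (\<integral>y. (norm (m - \<phi> (x * y)))\<^sup>2 \<partial>M)" by simp
  then have "(norm m)\<^sup>2 \<le> S" unfolding expand by (simp add: power2_norm_eq_inner)
  moreover have "(norm (lazy M \<phi> x))\<^sup>2 = (1/4) * ((norm a)\<^sup>2 + 2 * (a \<bullet> m) + (norm m)\<^sup>2)"
    unfolding lazy_def m_def a_def
    by (simp add: power_divide power2_norm_eq_inner inner_add_left inner_add_right inner_commute)
  moreover have "lazy M (\<lambda>z. (norm (\<phi> z))\<^sup>2) x = (1/2) * ((norm a)\<^sup>2 + S)"
    by (simp add: lazy_def S_def a_def)
  ultimately show ?thesis
    unfolding expand a_def[symmetric] by argo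
qed

lemma lazy_Jensen:
  fixes \<phi> :: "real \<Rightarrow> complex"
  assumes "bounded_borel \<phi>"
  shows "(norm (lazy M \<phi> x))\<^sup>2 \<le> lazy M (\<lambda>z. (norm (\<phi> z))\<^sup>2) x"
proof -
  have "0 \<le> (\<integral>y. (norm (\<phi> x - \<phi> (x * y)))\<^sup>2 \<partial>M)" by simp
  then show ?thesis using lazy_variance[OF assms, of x] by linarith
qed

lemma integral_lazy_swap:
  fixes \<phi> :: "'z \<Rightarrow> real \<Rightarrow> real"
  assumes N: "prob_space N" and f: "bounded_family N \<phi>"
  shows "(\<integral>z. lazy M (\<phi> z) x \<partial>N) = lazy M (\<lambda>x. \<integral>z. \<phi> z x \<partial>N) x"
proof -
  interpret N: prob_space N by fact
  interpret P: pair_prob_space N M ..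
  from f obtain C where C: "\<And>z x. norm (\<phi> z x) \<le> C" unfolding bounded_family_def by auto
  have mm: "(\<lambda>(z, y). \<phi> z (x * y)) \<in> borel_measurable (N \<Otimes>\<^sub>M M)"
    unfolding case_prod_beta by (rule bounded_family_measurable[OF f]) measurable
  then have "integrable (N \<Otimes>\<^sub>M M) (\<lambda>(z, y). \<phi> z (x * y))"
    using C by (intro P.integrable_const_bound[of _ C]) auto
  from P.Fubini_integral[OF this]
  have "(\<integral>z. mavg M (\<phi> z) x \<partial>N) = mavg M (\<lambda>x. \<integral>z. \<phi> z x \<partial>N) x"
    by (simp add: mavg_def)
  moreover have "integrable N (\<lambda>z. \<phi> z x)"
    using C by (intro N.integrable_const_bound[of _ C] bounded_family_measurable[OF f]) auto
  moreover have "integrable N (\<lambda>z. mavg M (\<phi> z) x)"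
  proof -
    obtain D where "\<And>z x. norm (mavg M (\<phi> z) x) \<le> D"
      using bounded_family_mavg[OF f] unfolding bounded_family_def by auto
    then show ?thesis
      by (intro N.integrable_const_bound[of _ D] bounded_family_measurable[OF bounded_family_mavg[OF f]]) auto
  qed
  ultimately show ?thesis by (simp add: lazy_def)
qed

lemma bounded_borel_integral:
  fixes \<phi> :: "'z \<Rightarrow> real \<Rightarrow> real"
  assumes N: "prob_space N" and f: "bounded_family N \<phi>"
  shows "bounded_borel (\<lambda>x. \<integral>z. \<phi> z x \<partial>N)"
proof -
  interpret N: prob_space N by fact
  from f obtain C where C: "\<And>z x. norm (\<phi> z x) \<le> C" unfolding bounded_family_def by auto
  have "(\<lambda>(x, z). \<phi> z x) \<in> borel_measurable (borel \<Otimes>\<^sub>M N)"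
    unfolding case_prod_beta by (rule bounded_family_measurable[OF f]) measurable
  then have "(\<lambda>x. \<integral>z. \<phi> z x \<partial>N) \<in> borel_measurable borel"
    by (rule N.borel_measurable_lebesgue_integral)
  moreover have "norm (\<integral>z. \<phi> z x \<partial>N) \<le> C" for x
  proof -
    have i: "integrable N (\<lambda>z. \<phi> z x)"
      using C by (intro N.integrable_const_bound[of _ C] bounded_family_measurable[OF f]) auto
    have "norm (\<integral>z. \<phi> z x \<partial>N) \<le> (\<integral>z. norm (\<phi> z x) \<partial>N)" by simp
    also have "\<dots> \<le> (\<integral>z. C \<partial>N)" using C i by (intro integral_mono integrable_norm) auto
    finally show ?thesis by (simp add: N.prob_space)
  qed
  ultimately show ?thesis unfolding bounded_borel_def by blast
qed

lemma bounded_family_incr: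
  assumes "bounded_family N \<phi>"
  shows "bounded_family (N \<Otimes>\<^sub>M M) (\<lambda>(z, y) x. \<phi> z x - \<phi> z (x * y))"
proof -
  from assms obtain C where C: "\<And>z x. norm (\<phi> z x) \<le> C" unfolding bounded_family_def by auto
  have "norm (\<phi> z x - \<phi> z (x * y)) \<le> C + C" for z x y
    using C by (meson add_mono norm_triangle_ineq4 order_trans)
  moreover have "(\<lambda>p. \<phi> (fst (fst p)) (snd p) - \<phi> (fst (fst p)) (snd p * snd (fst p)))
     \<in> borel_measurable ((N \<Otimes>\<^sub>M M) \<Otimes>\<^sub>M borel)"
    by (intro borel_measurable_diff bounded_family_measurable[OF assms]) measurable
  ultimately show ?thesis unfolding bounded_family_def case_prod_beta by blast
qed

lemma bounded_borel_incr_fam: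
  assumes "bounded_borel \<phi>"
  shows "bounded_family M (\<lambda>y x. \<phi> x - \<phi> (x * y))"
proof -
  from assms obtain C where C: "\<And>x. norm (\<phi> x) \<le> C" unfolding bounded_borel_def by auto
  have "norm (\<phi> x - \<phi> (x * y)) \<le> C + C" for x y
    using C by (meson add_mono norm_triangle_ineq4 order_trans)
  moreover have "(\<lambda>p. \<phi> (snd p) - \<phi> (snd p * fst p)) \<in> borel_measurable (M \<Otimes>\<^sub>M borel)"
    by (intro borel_measurable_diff measurable_compose[OF _ bounded_borel_measurable[OF assms]]) measurable
  ultimately show ?thesis unfolding bounded_family_def by (auto simp: case_prod_beta)
qed

text \<open>
  The factors commute, so differences in direction \<open>y\<close> commute with averaging; Jensen's inequality does
  the rest.
\<close>

lemma lazy_energy_decreases: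
  fixes \<phi> :: "real \<Rightarrow> complex"
  assumes "bounded_borel \<phi>"
  shows "(\<integral>y. (norm (lazy M \<phi> x - lazy M \<phi> (x * y)))\<^sup>2 \<partial>M)
    \<le> lazy M (\<lambda>z. \<integral>y. (norm (\<phi> z - \<phi> (z * y)))\<^sup>2 \<partial>M) x"
proof -
  have f: "bounded_family M (\<lambda>y x. (norm (\<phi> x - \<phi> (x * y)))\<^sup>2)"
    by (rule bounded_family_norm2[OF bounded_borel_incr_fam[OF assms]])
  have f': "bounded_family M (\<lambda>y x. (norm (lazy M \<phi> x - lazy M \<phi> (x * y)))\<^sup>2)"
    by (rule bounded_family_norm2[OF bounded_borel_incr_fam[OF bounded_borel_lazy[OF assms]]])
  have int: "integrable M (\<lambda>y. F y x)" if F: "bounded_family M F" for F :: "real \<Rightarrow> real \<Rightarrow> real"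
  proof -
    obtain D where "\<And>z x. norm (F z x) \<le> D" using F unfolding bounded_family_def by auto
    then show ?thesis by (intro integrable_const_bound[of _ D] bounded_family_measurable[OF F]) auto
  qed
  have "(\<integral>y. (norm (lazy M \<phi> x - lazy M \<phi> (x * y)))\<^sup>2 \<partial>M)
      \<le> (\<integral>y. lazy M (\<lambda>z. (norm (\<phi> z - \<phi> (z * y)))\<^sup>2) x \<partial>M)"
  proof (rule integral_mono)
    show "integrable M (\<lambda>y. (norm (lazy M \<phi> x - lazy M \<phi> (x * y)))\<^sup>2)" by (rule int[OF f'])
    show "integrable M (\<lambda>y. lazy M (\<lambda>z. (norm (\<phi> z - \<phi> (z * y)))\<^sup>2) x)"
      by (rule int[OF bounded_family_lazy[OF f]])
    fix y
    have "lazy M \<phi> x - lazy M \<phi> (x * y) = lazy M (\<lambda>z. \<phi> z - \<phi> (z * y)) x"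
      using assms by (simp add: lazy_diff bounded_borel_scale lazy_scale)
    then show "(norm (lazy M \<phi> x - lazy M \<phi> (x * y)))\<^sup>2 \<le> lazy M (\<lambda>z. (norm (\<phi> z - \<phi> (z * y)))\<^sup>2) x"
      using lazy_Jensen[of "\<lambda>z. \<phi> z - \<phi> (z * y)" x] assms by (simp add: bounded_borel_diff bounded_borel_scale)
  qed
  also have "\<dots> = lazy M (\<lambda>z. \<integral>y. (norm (\<phi> z - \<phi> (z * y)))\<^sup>2 \<partial>M) x"
    by (rule integral_lazy_swap[OF _ f]) (rule prob_space_axioms)
  finally show ?thesis .
qed

text \<open>
  The variance accumulated in \<open>n + 1\<close> lazy steps is at most the second moment of \<open>\<phi>\<close> at the end. Each step
  contributes at least a quarter of the energy of the function present at that step, and the energies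
  decrease, so the last and smallest one is counted \<open>n + 1\<close> times.
\<close>

lemma lazy_smoothing:
  fixes \<phi> :: "real \<Rightarrow> complex"
  assumes "bounded_borel \<phi>"
  shows "(real n + 1) / 4 * (\<integral>y. (norm ((lazy M ^^ n) \<phi> x - (lazy M ^^ n) \<phi> (x * y)))\<^sup>2 \<partial>M)
      + (norm ((lazy M ^^ Suc n) \<phi> x))\<^sup>2 \<le> (lazy M ^^ Suc n) (\<lambda>z. (norm (\<phi> z))\<^sup>2) x"
proof (induction n arbitrary: x)
  case 0
  then show ?case using lazy_variance[OF assms, of x] by simp
next
  case (Suc n)
  let ?W = "\<lambda>k. (lazy M ^^ k)"
  let ?E = "\<lambda>\<phi> z. \<integral>y. (norm (\<phi> z - \<phi> (z * y)))\<^sup>2 \<partial>M"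
  have bE: "bounded_borel (?E \<theta>)" if "bounded_borel \<theta>" for \<theta> :: "real \<Rightarrow> complex"
    by (rule bounded_borel_integral[OF prob_space_axioms bounded_family_norm2[OF bounded_borel_incr_fam[OF that]]])
  have b1: "bounded_borel (?W k \<phi>)" for k by (rule bounded_borel_lazy_pow[OF assms])
  have b2: "bounded_borel (?W k (\<lambda>z. (norm (\<phi> z))\<^sup>2))" for k by (rule bounded_borel_lazy_pow[OF bounded_borel_norm2[OF assms]])
  let ?c = "(real n + 1) / 4"
  have lin: "lazy M (\<lambda>z. c * f z + g z) x = c * lazy M f x + lazy M g x" and
    blin: "bounded_borel (\<lambda>z. c * f z + g z)"
    if "bounded_borel f" "bounded_borel g" for f g :: "real \<Rightarrow> real" and c
  proof -
    show "lazy M (\<lambda>z. c * f z + g z) x = c * lazy M f x + lazy M g x"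
      using integrable_bounded_borel[OF that(1), of x] integrable_bounded_borel[OF that(2), of x]
      unfolding lazy_def mavg_def by (simp add: algebra_simps)
    obtain C D where C: "\<And>x. norm (f x) \<le> C" "\<And>x. norm (g x) \<le> D"
      using \<open>bounded_borel f\<close> \<open>bounded_borel g\<close> unfolding bounded_borel_def by auto
    have "norm (c * f z + g z) \<le> \<bar>c\<bar> * C + D" for z
      using C(1)[of z] C(2)[of z] by (intro order_trans[OF norm_triangle_ineq] add_mono)
       (auto simp: abs_mult mult_left_mono)
    then show "bounded_borel (\<lambda>z. c * f z + g z)"
      using \<open>bounded_borel f\<close> \<open>bounded_borel g\<close> unfolding bounded_borel_def by auto
  qed
  have "(real (Suc n) + 1) / 4 * ?E (?W (Suc n) \<phi>) x + (norm (?W (Suc (Suc n)) \<phi> x))\<^sup>2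
     = ?c * ?E (?W (Suc n) \<phi>) x + ((1/4) * ?E (?W (Suc n) \<phi>) x + (norm (lazy M (?W (Suc n) \<phi>) x))\<^sup>2)"
    by (simp add: field_simps)
  also have "\<dots> \<le> ?c * lazy M (?E (?W n \<phi>)) x + lazy M (\<lambda>z. (norm (?W (Suc n) \<phi> z))\<^sup>2) x"
    using lazy_energy_decreases[OF b1[of n], of x] lazy_variance[OF b1[of "Suc n"], of x]
    by (intro add_mono mult_left_mono) auto
  also have "\<dots> = lazy M (\<lambda>z. ?c * ?E (?W n \<phi>) z + (norm (?W (Suc n) \<phi> z))\<^sup>2) x"
    by (rule lin[symmetric]) (intro bE b1 bounded_borel_norm2)+
  also have "\<dots> \<le> lazy M (?W (Suc n) (\<lambda>z. (norm (\<phi> z))\<^sup>2)) x"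
    using Suc by (intro lazy_mono blin bE b1 b2 bounded_borel_norm2) auto
  finally show ?case by simp
qed

lemma integral_lazy_pow_le:
  fixes \<phi> :: "'z \<Rightarrow> real \<Rightarrow> real"
  assumes N: "prob_space N" and f: "bounded_family N \<phi>" and B: "\<And>x. (\<integral>z. \<phi> z x \<partial>N) \<le> B"
  shows "(\<integral>z. (lazy M ^^ n) (\<phi> z) x \<partial>N) \<le> B"
proof (induction n arbitrary: x)
  case 0
  then show ?case using B by simp
next
  case (Suc n)
  have g: "bounded_family N (\<lambda>z. (lazy M ^^ n) (\<phi> z))" by (rule bounded_family_lazy_pow[OF f])
  have "(\<integral>z. (lazy M ^^ Suc n) (\<phi> z) x \<partial>N) = lazy M (\<lambda>x. \<integral>z. (lazy M ^^ n) (\<phi> z) x \<partial>N) x"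
    using integral_lazy_swap[OF N g] by simp
  also have "\<dots> \<le> lazy M (\<lambda>x. B) x"
    using Suc by (intro lazy_mono bounded_borel_integral[OF N g]) (auto simp: bounded_borel_def)
  also have "\<dots> = B" by (simp add: lazy_def mavg_def)
  finally show ?case .
qed

text \<open>
  The same estimate for a family of functions, in mean square over the parameter. The differences
  form a family with one more parameter, so the estimate can be applied to them again, and every round
  gains another factor \<open>1 / (n + 1)\<close>.
\<close>

lemma family_smoothing:
  fixes \<phi> :: "'z \<Rightarrow> real \<Rightarrow> complex"
  assumes N: "prob_space N" and f: "bounded_family N \<phi>" and B: "\<And>x. (\<integral>z. (norm (\<phi> z x))\<^sup>2 \<partial>N) \<le> B"
  shows "(\<integral>(z, y). (norm ((lazy M ^^ n) (\<phi> z) x - (lazy M ^^ n) (\<phi> z) (x * y)))\<^sup>2 \<partial>(N \<Otimes>\<^sub>M M))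
     \<le> 4 * B / (real n + 1)"
proof -
  interpret N: prob_space N by fact
  interpret P: pair_prob_space N M ..
  let ?F = "\<lambda>z y. (norm ((lazy M ^^ n) (\<phi> z) x - (lazy M ^^ n) (\<phi> z) (x * y)))\<^sup>2"
  let ?G = "\<lambda>z. (lazy M ^^ Suc n) (\<lambda>x. (norm (\<phi> z x))\<^sup>2) x"
  have "bounded_family (N \<Otimes>\<^sub>M M) (\<lambda>p x. (norm ((case p of (z, y) \<Rightarrow> \<lambda>x. (lazy M ^^ n) (\<phi> z) x - (lazy M ^^ n) (\<phi> z) (x * y)) x))\<^sup>2)"
    by (intro bounded_family_norm2 bounded_family_incr bounded_family_lazy_pow f)
  then have fam: "bounded_family (N \<Otimes>\<^sub>M M) (\<lambda>p x. (norm ((lazy M ^^ n) (\<phi> (fst p)) x - (lazy M ^^ n) (\<phi> (fst p)) (x * snd p)))\<^sup>2)"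
    by (simp add: case_prod_beta)
  have int: "integrable (N \<Otimes>\<^sub>M M) (\<lambda>(z, y). ?F z y)"
  proof -
    obtain D where "\<And>z x. norm ((\<lambda>p x. (norm ((lazy M ^^ n) (\<phi> (fst p)) x - (lazy M ^^ n) (\<phi> (fst p)) (x * snd p)))\<^sup>2) z x) \<le> D"
      using fam unfolding bounded_family_def by blast
    then show ?thesis unfolding case_prod_beta
      by (intro P.integrable_const_bound[of _ D] bounded_family_measurable[OF fam]) auto
  qed
  have g: "bounded_family N (\<lambda>z. (lazy M ^^ Suc n) (\<lambda>x. (norm (\<phi> z x))\<^sup>2))"
    by (rule bounded_family_lazy_pow[OF bounded_family_norm2[OF f]])
  have intG: "integrable N ?G"
  proof -
    obtain D where "\<And>z x. norm ((lazy M ^^ Suc n) (\<lambda>x. (norm (\<phi> z x))\<^sup>2) x) \<le> D"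
      using g unfolding bounded_family_def by blast
    then show ?thesis
      by (intro N.integrable_const_bound[of _ D] bounded_family_measurable[OF g]) auto
  qed
  have "(\<integral>p. (case p of (z, y) \<Rightarrow> ?F z y) \<partial>(N \<Otimes>\<^sub>M M)) = (\<integral>z. (\<integral>y. ?F z y \<partial>M) \<partial>N)"
    using P.integral_fst'[OF int] by simp
  also have "\<dots> \<le> (\<integral>z. 4 / (real n + 1) * ?G z \<partial>N)"
  proof (rule integral_mono)
    show "integrable N (\<lambda>z. \<integral>y. ?F z y \<partial>M)" using P.integrable_fst'[OF int] by simp
    show "integrable N (\<lambda>z. 4 / (real n + 1) * ?G z)" using intG by simp
    fix z assume "z \<in> space N"
    then have "bounded_borel (\<phi> z)" by (rule bounded_family_bounded_borel[OF f])
    from lazy_smoothing[OF this, of n x]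
    have "(real n + 1) / 4 * (\<integral>y. ?F z y \<partial>M) \<le> ?G z"
      by (smt (verit) zero_le_power2)
    then show "(\<integral>y. ?F z y \<partial>M) \<le> 4 / (real n + 1) * ?G z"
      by (simp add: field_simps)
  qed
  also have "\<dots> = 4 / (real n + 1) * (\<integral>z. ?G z \<partial>N)" by simp
  also have "\<dots> \<le> 4 / (real n + 1) * B"
    by (intro mult_left_mono integral_lazy_pow_le[OF N bounded_family_norm2[OF f]] B) auto
  finally show ?thesis by simp
qed

end

section \<open>Functions whose potential vanishes\<close>

text \<open>
  Going from \<open>n\<close> to \<open>n + 1\<close> replaces a sequence by the means of its consecutive terms. All rows are
  small far out, uniformly in \<open>n\<close>, because a mean never exceeds its terms. From there the smallness
  spreads down to every fixed index: in the column \<open>j\<close> the old value is halved at each step, while the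
  column \<open>j + 1\<close> contributes at most half of its own small bound.
\<close>

lemma euler_transform_null:
  fixes t :: "nat \<Rightarrow> nat \<Rightarrow> complex"
  assumes rec: "\<And>j n. t j (Suc n) = (t j n + t (Suc j) n) / 2"
    and lim: "(\<lambda>j. t j 0) \<longlonglongrightarrow> 0"
  shows "t j \<longlonglongrightarrow> 0"
proof (rule LIMSEQ_I)
  fix r :: real assume "r > 0"
  define e where "e = r / 2"
  have e: "0 < e" "e < r" using \<open>r > 0\<close> by (auto simp: e_def)
  obtain K where K: "\<And>j. j \<ge> K \<Longrightarrow> norm (t j 0) < e"
    using LIMSEQ_D[OF lim e(1)] by auto
  have half: "norm (t j (Suc n)) \<le> norm (t j n) / 2 + norm (t (Suc j) n) / 2" for j n
    unfolding rec by (simp add: norm_divide add_divide_distrib[symmetric] divide_right_mono norm_triangle_ineq)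
  have far: "norm (t j n) < e" if "j \<ge> K" for j n
    using that
  proof (induction n arbitrary: j)
    case (Suc n)
    have "norm (t j n) < e" "norm (t (Suc j) n) < e" using Suc by auto
    then show ?case using half[of j n] by linarith
  qed (use K in auto)
  have "\<forall>d>e. eventually (\<lambda>n. norm (t j n) < d) sequentially" for j
  proof (cases "j \<ge> K")
    case True
    then have "\<forall>n. norm (t j n) < e" using far by blast
    then show ?thesis by (meson always_eventually less_trans)
  next
    case False
    then have "j \<le> K" by simp
    then show ?thesis
    proof (induction rule: inc_induct)
      case base
      have "\<forall>n. norm (t K n) < e" using far by blast
      then show ?case by (meson always_eventually less_trans)
    next
      case (step j)
      show ?case
      proof (intro allI impI)
        fix d assume "d > e"
        define d' where "d' = (d + e) / 2"
        have d': "e < d'" "d' < d" using \<open>d > e\<close> by (auto simp: d'_def)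
        from step.IH d'(1) obtain N where N: "\<And>n. n \<ge> N \<Longrightarrow> norm (t (Suc j) n) < d'"
          unfolding eventually_sequentially by blast
        have geo: "norm (t j (N + k)) \<le> d' + norm (t j N) * (1/2) ^ k" for k
        proof (induction k)
          case 0
          then show ?case using d' e by simp
        next
          case (Suc k)
          have "norm (t j (N + Suc k)) \<le> norm (t j (N + k)) / 2 + d' / 2"
            using half[of j "N + k"] N[of "N + k"] by simp
          also have "\<dots> \<le> (d' + norm (t j N) * (1/2) ^ k) / 2 + d' / 2"
            using Suc by (intro add_right_mono divide_right_mono) auto
          finally show ?case by (simp add: field_simps)
        qed
        have "(\<lambda>k. d' + norm (t j N) * (1/2) ^ k) \<longlonglongrightarrow> d' + norm (t j N) * 0"
          by (intro tendsto_intros LIMSEQ_power_zero) auto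
        then have "eventually (\<lambda>k. d' + norm (t j N) * (1/2) ^ k < d) sequentially"
          using d' by (intro order_tendstoD) auto
        then have "eventually (\<lambda>k. norm (t j (k + N)) < d) sequentially"
        proof (rule eventually_mono)
          fix k assume "d' + norm (t j N) * (1/2) ^ k < d"
          with geo[of k] show "norm (t j (k + N)) < d" unfolding add.commute[of k N] by (rule le_less_trans)
        qed
        then show "eventually (\<lambda>n. norm (t j n) < d) sequentially"
          by (rule eventually_sequentially_seg[THEN iffD1])
      qed
    qed
  qed
  from this[of j] e show "\<exists>no. \<forall>n\<ge>no. norm (t j n - 0) < r"
    unfolding eventually_sequentially by auto
qed

text \<open>
  Euler summation keeps the sum of a convergent series, here for the sum zero. Half of the transformed
  partial sum, plus the partial sum of the row \<open>n\<close> up to \<open>j\<close>, is again a triangle of successive means, and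
  it starts from the partial sums of the given series.
\<close>

lemma euler_sum_null:
  fixes u :: "nat \<Rightarrow> nat \<Rightarrow> complex"
  assumes rec: "\<And>j n. u j (Suc n) = (u j n + u (Suc j) n) / 2"
    and lim: "(\<lambda>N. \<Sum>j<N. u j 0) \<longlonglongrightarrow> 0"
  shows "(\<lambda>N. \<Sum>n<N. u 0 n) \<longlonglongrightarrow> 0"
proof -
  define t where "t j n = (\<Sum>i<n. u 0 i) / 2 + (\<Sum>k<j. u k n)" for j n
  have "t j (Suc n) = (t j n + t (Suc j) n) / 2" for j n
  proof -
    have 1: "(\<Sum>k<j. u k (Suc n)) = ((\<Sum>k<j. u k n) + (\<Sum>k<j. u (Suc k) n)) / 2"
      by (simp add: rec sum.distrib sum_divide_distrib[symmetric])
    have 2: "(\<Sum>k<j. u (Suc k) n) = (\<Sum>k<Suc j. u k n) - u 0 n"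
      by (simp add: sum.lessThan_Suc_shift del: sum.lessThan_Suc)
    show ?thesis
      unfolding t_def 1 2 by (simp add: field_simps)
  qed
  moreover have "(\<lambda>j. t j 0) \<longlonglongrightarrow> 0" using lim by (simp add: t_def)
  ultimately have "t 0 \<longlonglongrightarrow> 0" by (rule euler_transform_null)
  moreover have "t 0 = (\<lambda>n. (\<Sum>i<n. u 0 i) / 2)" by (simp add: t_def fun_eq_iff)
  ultimately have "(\<lambda>n. (\<Sum>i<n. u 0 i) / 2) \<longlonglongrightarrow> 0" by simp
  from tendsto_mult_right[OF this, of 2] show ?thesis by simp
qed

text \<open>
  Bounded second moments make the sequence uniformly integrable: cutting at the height \<open>K\<close> costs at most
  \<open>B / K\<close>, and the cut functions converge by dominated convergence.
\<close>

lemma (in prob_space) integral_null_if_L2_bounded: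
  fixes F :: "nat \<Rightarrow> 'a \<Rightarrow> complex"
  assumes meas [measurable]: "\<And>n. F n \<in> borel_measurable M"
    and int: "\<And>n. integrable M (\<lambda>p. (norm (F n p))\<^sup>2)"
    and B: "\<And>n. (\<integral>p. (norm (F n p))\<^sup>2 \<partial>M) \<le> B"
    and lim: "\<And>p. (\<lambda>n. F n p) \<longlonglongrightarrow> 0"
  shows "(\<lambda>n. \<integral>p. F n p \<partial>M) \<longlonglongrightarrow> 0"
proof (rule LIMSEQ_I)
  fix r :: real assume "r > 0"
  have "0 \<le> (\<integral>p. (norm (F 0 p))\<^sup>2 \<partial>M)" by simp
  then have "0 \<le> B" using B[of 0] by linarith
  define K where "K = 2 * (B + 1) / r"
  have K: "K > 0" "B / K < r / 2" using \<open>r > 0\<close> \<open>0 \<le> B\<close> by (auto simp: K_def field_simps)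
  have "(\<lambda>n. \<integral>p. min (norm (F n p)) K \<partial>M) \<longlonglongrightarrow> (\<integral>p. 0 \<partial>M)"
  proof (rule integral_dominated_convergence[where w = "\<lambda>_. K"])
    show "AE p in M. (\<lambda>n. min (norm (F n p)) K) \<longlonglongrightarrow> 0"
    proof (rule AE_I2)
      fix p
      have "(\<lambda>n. min (norm (F n p)) K) \<longlonglongrightarrow> min (norm (0::complex)) K"
        by (intro tendsto_intros lim)
      then show "(\<lambda>n. min (norm (F n p)) K) \<longlonglongrightarrow> 0" using K by simp
    qed
  qed (use K in auto)
  then have null: "(\<lambda>n. \<integral>p. min (norm (F n p)) K \<partial>M) \<longlonglongrightarrow> 0" by simp
  have "0 < r / 2" using \<open>r > 0\<close> by simp
  from LIMSEQ_D[OF null this]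
  obtain N where N: "\<And>n. n \<ge> N \<Longrightarrow> norm (\<integral>p. min (norm (F n p)) K \<partial>M) < r / 2"
    by auto
  have "norm (\<integral>p. F n p \<partial>M) < r" if "n \<ge> N" for n
  proof -
    have pw: "norm z \<le> min (norm z) K + (norm z)\<^sup>2 / K" for z :: complex
    proof (cases "norm z \<le> K")
      case False
      then have "norm z * K \<le> norm z * norm z" by (intro mult_left_mono) auto
      then have "norm z \<le> (norm z)\<^sup>2 / K" using K by (simp add: field_simps power2_eq_square)
      then show ?thesis using K False by (simp add: min_def)
    qed (use K in auto)
    have i1: "integrable M (\<lambda>p. min (norm (F n p)) K)"
      using K by (intro integrable_const_bound[of _ K]) auto
    have i2: "integrable M (\<lambda>p. min (norm (F n p)) K + (norm (F n p))\<^sup>2 / K)"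
      using i1 int[of n] by simp
    have "integrable M (F n)"
      by (rule Bochner_Integration.integrable_bound[OF i2 meas]) (use pw in \<open>auto intro!: AE_I2 order_trans[OF pw]\<close>)
    have "norm (\<integral>p. F n p \<partial>M) \<le> (\<integral>p. norm (F n p) \<partial>M)" by simp
    also have "\<dots> \<le> (\<integral>p. min (norm (F n p)) K + (norm (F n p))\<^sup>2 / K \<partial>M)"
      using pw by (intro integral_mono integrable_norm \<open>integrable M (F n)\<close> i2)
    also have "\<dots> = (\<integral>p. min (norm (F n p)) K \<partial>M) + (\<integral>p. (norm (F n p))\<^sup>2 \<partial>M) / K"
      using i1 int[of n] by simp
    also have "\<dots> \<le> norm (\<integral>p. min (norm (F n p)) K \<partial>M) + B / K"
      using B[of n] K by (intro add_mono divide_right_mono) auto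
    also have "\<dots> < r" using N[OF that] K by linarith
    finally show ?thesis .
  qed
  then show "\<exists>no. \<forall>n\<ge>no. norm ((\<integral>p. F n p \<partial>M) - 0) < r" by auto
qed

definition scale_diff :: "real \<Rightarrow> (real \<Rightarrow> complex) \<Rightarrow> real \<Rightarrow> complex" where
  "scale_diff y \<phi> x = \<phi> x - \<phi> (x * y)"

definition scale_diff3 :: "(real \<Rightarrow> complex) \<Rightarrow> real \<Rightarrow> (real \<times> real) \<times> real \<Rightarrow> complex" where
  "scale_diff3 \<phi> x p = scale_diff (snd p) (scale_diff (snd (fst p)) (scale_diff (fst (fst p)) \<phi>)) x"

lemma bounded_borel_scale_diff: "bounded_borel \<phi> \<Longrightarrow> bounded_borel (scale_diff y \<phi>)"
  unfolding scale_diff_def by (intro bounded_borel_diff bounded_borel_scale)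

context real_distribution
begin

lemma lazy_pow_norm_le:
  assumes "bounded_borel \<phi>" "\<And>x. norm (\<phi> x) \<le> C"
  shows "norm ((lazy M ^^ n) \<phi> x) \<le> C"
proof (induction n arbitrary: x)
  case (Suc n)
  let ?\<theta> = "(lazy M ^^ n) \<phi>"
  have "norm (mavg M ?\<theta> x) \<le> C"
    by (rule mavg_norm_le[OF bounded_borel_lazy_pow[OF assms(1)] Suc])
  then have "norm (?\<theta> x + mavg M ?\<theta> x) \<le> C + C"
    by (intro order_trans[OF norm_triangle_ineq] add_mono Suc)
  then have "norm (lazy M ?\<theta> x) \<le> C"
    unfolding lazy_def norm_scaleR by simp
  then show ?case by simp
qed (use assms in auto)

lemma lazy_pow_scale_diff:
  assumes "bounded_borel \<phi>"
  shows "(lazy M ^^ n) (scale_diff y \<phi>) = scale_diff y ((lazy M ^^ n) \<phi>)"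
proof (induction n)
  case (Suc n)
  have "lazy M (scale_diff y \<theta>) = scale_diff y (lazy M \<theta>)" if "bounded_borel \<theta>" for \<theta>
    unfolding scale_diff_def using that by (simp add: lazy_diff bounded_borel_scale lazy_scale)
  from this[OF bounded_borel_lazy_pow[OF assms, of n]] show ?case by (simp add: Suc)
qed simp

lemma bounded_family_scale_diff3:
  assumes "bounded_borel \<phi>" shows "bounded_family ((M \<Otimes>\<^sub>M M) \<Otimes>\<^sub>M M) (\<lambda>p x. scale_diff3 \<phi> x p)"
proof -
  have "bounded_family ((M \<Otimes>\<^sub>M M) \<Otimes>\<^sub>M M) (\<lambda>(q, c) x. (\<lambda>(a, b) x. scale_diff a \<phi> x - scale_diff a \<phi> (x * b)) q x - (\<lambda>(a, b) x. scale_diff a \<phi> x - scale_diff a \<phi> (x * b)) q (x * c))"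
    unfolding scale_diff_def by (intro bounded_family_incr bounded_borel_incr_fam assms)
  also have "(\<lambda>(q, c) x. (\<lambda>(a, b) x. scale_diff a \<phi> x - scale_diff a \<phi> (x * b)) q x - (\<lambda>(a, b) x. scale_diff a \<phi> x - scale_diff a \<phi> (x * b)) q (x * c))
     = (\<lambda>p x. scale_diff3 \<phi> x p)"
    by (auto simp: scale_diff3_def scale_diff_def fun_eq_iff split: prod.splits)
  finally show ?thesis .
qed

text \<open>
  The \<open>3 m\<close> lazy steps are split into three blocks of length \<open>m\<close>, one for each difference. Differences
  commute with lazy averages, so every block pays for one factor \<open>4 / (m + 1)\<close>.
\<close>

lemma scale_diff3_lazy_power3:
  assumes b: "bounded_borel \<psi>" and C: "\<And>x. norm (\<psi> x) \<le> C"
  shows "(\<integral>p. (norm (scale_diff3 ((lazy M ^^ (m + (m + m))) \<psi>) x p))\<^sup>2 \<partial>((M \<Otimes>\<^sub>M M) \<Otimes>\<^sub>M M)) \<le> 64 * C\<^sup>2 / (real m + 1) ^ 3"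
proof -
  interpret P: pair_prob_space M M ..
  define W where "W = (lazy M ^^ m :: (real \<Rightarrow> complex) \<Rightarrow> _)"
  have bW: "bounded_borel (W \<phi>)" if "bounded_borel \<phi>" for \<phi> :: "real \<Rightarrow> complex"
    unfolding W_def by (rule bounded_borel_lazy_pow[OF that])
  have Wd: "W (scale_diff y \<phi>) = scale_diff y (W \<phi>)" if "bounded_borel \<phi>" for \<phi> y
    unfolding W_def by (rule lazy_pow_scale_diff[OF that])
  define B where "B = 4 * C\<^sup>2 / (real m + 1)"
  have B1: "(\<integral>a. (norm (scale_diff a (W \<psi>) x))\<^sup>2 \<partial>M) \<le> B" for x
  proof -
    have "norm ((lazy M ^^ Suc m) (\<lambda>z. (norm (\<psi> z))\<^sup>2) x) \<le> C\<^sup>2"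
      by (rule lazy_pow_norm_le[OF bounded_borel_norm2[OF b]]) (use C in \<open>auto intro: power_mono\<close>)
    then have "(lazy M ^^ Suc m) (\<lambda>z. (norm (\<psi> z))\<^sup>2) x \<le> C\<^sup>2"
      unfolding real_norm_def by (meson abs_le_D1)
    moreover have "0 \<le> (norm ((lazy M ^^ Suc m) \<psi> x))\<^sup>2" by simp
    ultimately have "(real m + 1) / 4 * (\<integral>a. (norm (scale_diff a (W \<psi>) x))\<^sup>2 \<partial>M) \<le> C\<^sup>2"
      using lazy_smoothing[OF b, of m x] unfolding W_def scale_diff_def by linarith
    then show ?thesis by (simp add: B_def field_simps)
  qed
  have f1: "bounded_family M (\<lambda>a. scale_diff a (W \<psi>))"
    unfolding scale_diff_def by (rule bounded_borel_incr_fam[OF bW[OF b]])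
  define \<phi>2 where "\<phi>2 = (\<lambda>(a, b) x. W (scale_diff a (W \<psi>)) x - W (scale_diff a (W \<psi>)) (x * b))"
  have f2: "bounded_family (M \<Otimes>\<^sub>M M) \<phi>2"
    unfolding \<phi>2_def W_def
    by (intro bounded_family_incr bounded_family_lazy_pow) (use f1 in \<open>simp add: W_def\<close>)
  have B2: "(\<integral>q. (norm (\<phi>2 q x))\<^sup>2 \<partial>(M \<Otimes>\<^sub>M M)) \<le> 4 * B / (real m + 1)" for x
    using family_smoothing[OF prob_space_axioms f1 B1, of m x]
    unfolding \<phi>2_def W_def by (simp add: case_prod_unfold)
  have B3: "(\<integral>(q, c). (norm (W (\<phi>2 q) x - W (\<phi>2 q) (x * c)))\<^sup>2 \<partial>((M \<Otimes>\<^sub>M M) \<Otimes>\<^sub>M M))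
      \<le> 4 * (4 * B / (real m + 1)) / (real m + 1)"
    using family_smoothing[OF P.prob_space_axioms f2 B2, of m x] unfolding W_def .
  have "W (\<phi>2 q) x - W (\<phi>2 q) (x * c) = scale_diff3 ((lazy M ^^ (m + (m + m))) \<psi>) x (q, c)" for q c
  proof -
    obtain a b where q: "q = (a, b)" by force
    have "\<phi>2 q = scale_diff b (W (scale_diff a (W \<psi>)))" unfolding q \<phi>2_def scale_diff_def by auto
    also have "\<dots> = scale_diff b (scale_diff a (W (W \<psi>)))" using bW b by (simp add: Wd)
    finally have "W (\<phi>2 q) = scale_diff b (scale_diff a (W (W (W \<psi>))))"
      using bW b by (simp add: Wd bounded_borel_scale_diff)
    moreover have "W (W (W \<psi>)) = (lazy M ^^ (m + (m + m))) \<psi>"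
      by (simp add: W_def funpow_add)
    ultimately show ?thesis unfolding scale_diff3_def q by (simp add: scale_diff_def)
  qed
  with B3 have "(\<integral>p. (norm (scale_diff3 ((lazy M ^^ (m + (m + m))) \<psi>) x p))\<^sup>2 \<partial>((M \<Otimes>\<^sub>M M) \<Otimes>\<^sub>M M))
      \<le> 4 * (4 * B / (real m + 1)) / (real m + 1)"
    by (simp add: case_prod_unfold)
  also have "\<dots> = 64 * C\<^sup>2 / (real m + 1) ^ 3"
    unfolding B_def by (simp add: power3_eq_cube)
  finally show ?thesis .
qed

lemma scale_diff3_lazy_pow:
  assumes b: "bounded_borel \<psi>" and C: "\<And>x. norm (\<psi> x) \<le> C"
  shows "(\<integral>p. (norm (scale_diff3 ((lazy M ^^ n) \<psi>) x p))\<^sup>2 \<partial>((M \<Otimes>\<^sub>M M) \<Otimes>\<^sub>M M)) \<le> 1728 * C\<^sup>2 / (real n + 1) ^ 3"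
proof -
  define m r where "m = n div 3" and "r = n mod 3"
  have n: "n = (m + (m + m)) + r" unfolding m_def r_def by presburger
  have r: "r < 3" unfolding r_def by simp
  let ?\<psi> = "(lazy M ^^ r) \<psi>"
  have "(lazy M ^^ n) \<psi> = (lazy M ^^ (m + (m + m))) ?\<psi>"
    unfolding n by (subst funpow_add) simp
  then have "(\<integral>p. (norm (scale_diff3 ((lazy M ^^ n) \<psi>) x p))\<^sup>2 \<partial>((M \<Otimes>\<^sub>M M) \<Otimes>\<^sub>M M)) \<le> 64 * C\<^sup>2 / (real m + 1) ^ 3"
    using scale_diff3_lazy_power3[OF bounded_borel_lazy_pow[OF b, of r] lazy_pow_norm_le[OF b C], of m x] by simp
  also have "\<dots> \<le> 1728 * C\<^sup>2 / (real n + 1) ^ 3"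
  proof -
    have "(real n + 1) ^ 3 \<le> (3 * (real m + 1)) ^ 3"
      using r n by (intro power_mono) auto
    also have "\<dots> = 27 * (real m + 1) ^ 3" unfolding power_mult_distrib by simp
    finally have "64 * C\<^sup>2 * (real n + 1) ^ 3 \<le> 64 * C\<^sup>2 * (27 * (real m + 1) ^ 3)"
      by (intro mult_left_mono) auto
    then show ?thesis by (simp add: field_simps)
  qed
  finally show ?thesis .
qed

text \<open>
  The operator \<open>I - U\<close>: the mean over the step law of the differences \<open>scale_diff\<close>.
\<close>

definition (in -) defect :: "real measure \<Rightarrow> (real \<Rightarrow> complex) \<Rightarrow> real \<Rightarrow> complex" where
  "defect \<mu> \<phi> x = \<phi> x - mavg \<mu> \<phi> x"

lemma bounded_borel_defect: "bounded_borel \<phi> \<Longrightarrow> bounded_borel (defect M \<phi>)"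
  unfolding defect_def by (intro bounded_borel_diff bounded_borel_mavg)

lemma mavg_pow_defect:
  assumes "bounded_borel \<phi>"
  shows "(mavg M ^^ n) (defect M \<phi>) = (\<lambda>x. (mavg M ^^ n) \<phi> x - (mavg M ^^ Suc n) \<phi> x)"
  unfolding defect_def using mavg_pow_diff[OF assms bounded_borel_mavg[OF assms], of n]
  by (simp add: funpow_swap1)

lemma sum_mavg_pow_defect:
  assumes "bounded_borel \<phi>"
  shows "(\<Sum>n<N. (mavg M ^^ n) (defect M \<phi>) x) = \<phi> x - (mavg M ^^ N) \<phi> x"
  unfolding mavg_pow_defect[OF assms]
  using sum_lessThan_telescope'[of "\<lambda>n. (mavg M ^^ n) \<phi> x" N] by simp

lemma integral_scale_diff: "bounded_borel \<phi> \<Longrightarrow> (\<integral>y. scale_diff y \<phi> x \<partial>M) = defect M \<phi> x"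
  unfolding scale_diff_def defect_def mavg_def
  by (subst Bochner_Integration.integral_diff) (auto intro: integrable_bounded_borel)

lemma defect_scale_diff: "bounded_borel \<phi> \<Longrightarrow> defect M (scale_diff y \<phi>) = scale_diff y (defect M \<phi>)"
proof (rule ext)
  fix x assume b: "bounded_borel \<phi>"
  have "mavg M (scale_diff y \<phi>) x = mavg M \<phi> x - mavg M \<phi> (x * y)"
    using integrable_bounded_borel[OF b, of x] integrable_bounded_borel[OF b, of "x * y"]
    unfolding mavg_def scale_diff_def by (simp add: mult_ac)
  then show "defect M (scale_diff y \<phi>) x = scale_diff y (defect M \<phi>) x"
    by (simp add: defect_def scale_diff_def)
qed

lemma integral_scale_diff3:
  assumes b: "bounded_borel \<phi>"
  shows "(\<integral>p. scale_diff3 \<phi> x p \<partial>((M \<Otimes>\<^sub>M M) \<Otimes>\<^sub>M M)) = defect M (defect M (defect M \<phi>)) x"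
proof -
  interpret P: pair_prob_space M M ..
  interpret Q: pair_prob_space "M \<Otimes>\<^sub>M M" M ..
  note f = bounded_family_scale_diff3[OF b]
  obtain D where D: "\<And>p x. norm (scale_diff3 \<phi> x p) \<le> D" using f unfolding bounded_family_def by auto
  have i3: "integrable ((M \<Otimes>\<^sub>M M) \<Otimes>\<^sub>M M) (scale_diff3 \<phi> x)"
    using D by (intro Q.integrable_const_bound[of _ D] bounded_family_measurable[OF f]) auto
  have e: "(\<integral>c. scale_diff3 \<phi> x (q, c) \<partial>M) = scale_diff (snd q) (scale_diff (fst q) (defect M \<phi>)) x" for q
    unfolding scale_diff3_def using b by (simp add: integral_scale_diff bounded_borel_scale_diff defect_scale_diff)
  have i2: "integrable (M \<Otimes>\<^sub>M M) (\<lambda>q. scale_diff (snd q) (scale_diff (fst q) (defect M \<phi>)) x)"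
    using Q.integrable_fst'[OF i3] unfolding e .
  have "(\<integral>p. scale_diff3 \<phi> x p \<partial>((M \<Otimes>\<^sub>M M) \<Otimes>\<^sub>M M)) = (\<integral>q. scale_diff (snd q) (scale_diff (fst q) (defect M \<phi>)) x \<partial>(M \<Otimes>\<^sub>M M))"
    using Q.integral_fst'[OF i3] unfolding e by simp
  also have "\<dots> = (\<integral>a. \<integral>b. scale_diff b (scale_diff a (defect M \<phi>)) x \<partial>M \<partial>M)"
    using P.integral_fst'[OF i2] by simp
  also have "\<dots> = defect M (defect M (defect M \<phi>)) x"
    using b by (simp add: integral_scale_diff bounded_borel_scale_diff bounded_borel_defect defect_scale_diff)
  finally show ?thesis .
qed

lemma mavg_lazy: "bounded_borel \<phi> \<Longrightarrow> mavg M (lazy M \<phi>) = lazy M (mavg M \<phi>)"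
proof (rule ext)
  fix x assume b: "bounded_borel \<phi>"
  have "integrable M (\<lambda>y. mavg M \<phi> (x * y))" "integrable M (\<lambda>y. \<phi> (x * y))"
    by (intro integrable_bounded_borel bounded_borel_mavg b)+
  then show "mavg M (lazy M \<phi>) x = lazy M (mavg M \<phi>) x"
    unfolding lazy_def by (simp add: mavg_def[of M "\<lambda>x. _ *\<^sub>R _ x"]) (simp add: mavg_def)
qed

lemma mavg_pow_lazy: "bounded_borel \<phi> \<Longrightarrow> (mavg M ^^ j) (lazy M \<phi>) = lazy M ((mavg M ^^ j) \<phi>)"
  by (induction j) (auto simp: mavg_lazy bounded_borel_mavg_pow)

text \<open>
  The numbers \<open>U\<^sup>j W\<^sup>n \<psi> x\<close> form a triangle of successive means over the sequence \<open>U\<^sup>j \<psi> x\<close>, to which the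
  lemmas on Euler summation apply.
\<close>

lemma mavg_lazy_pow_rec:
  fixes \<psi> :: "real \<Rightarrow> complex"
  assumes "bounded_borel \<psi>"
  shows "(mavg M ^^ j) ((lazy M ^^ Suc n) \<psi>) x
    = ((mavg M ^^ j) ((lazy M ^^ n) \<psi>) x + (mavg M ^^ Suc j) ((lazy M ^^ n) \<psi>) x) / 2"
  using mavg_pow_lazy[OF bounded_borel_lazy_pow[OF assms], of j n]
  by (simp add: lazy_def scaleR_conv_of_real)

definition (in -) lazy_potential :: "real measure \<Rightarrow> (real \<Rightarrow> complex) \<Rightarrow> nat \<Rightarrow> real \<Rightarrow> complex" where
  "lazy_potential \<mu> \<psi> N x = (\<Sum>n<N. (lazy \<mu> ^^ n) \<psi> x)"

lemma bounded_borel_add: "bounded_borel \<phi> \<Longrightarrow> bounded_borel \<theta> \<Longrightarrow> bounded_borel (\<lambda>x. \<phi> x + \<theta> x)" for \<phi> \<theta> :: "real \<Rightarrow> complex"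
  using bounded_borel_diff[of \<phi> "\<lambda>x. 0 - \<theta> x"] bounded_borel_diff[of "\<lambda>x. 0" \<theta>] bounded_borel_const[of "0::complex"] by simp

lemma bounded_borel_lazy_potential: "bounded_borel \<psi> \<Longrightarrow> bounded_borel (lazy_potential M \<psi> N)"
proof (induction N)
  case 0
  then show ?case using bounded_borel_const[of "0::complex"] by (simp add: lazy_potential_def)
next
  case (Suc N)
  then show ?case unfolding lazy_potential_def by (simp add: bounded_borel_add bounded_borel_lazy_pow)
qed

text \<open>
  Since \<open>I - U = 2 (I - W)\<close>, the sum telescopes.
\<close>

lemma defect_lazy_potential:
  assumes "bounded_borel \<psi>"
  shows "defect M (lazy_potential M \<psi> N) = (\<lambda>x. 2 * (\<psi> x - (lazy M ^^ N) \<psi> x))"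
proof (induction N)
  case 0
  then show ?case by (simp add: defect_def mavg_def lazy_potential_def)
next
  case (Suc N)
  let ?\<theta> = "(lazy M ^^ N) \<psi>"
  have "defect M (lazy_potential M \<psi> (Suc N)) x = defect M (lazy_potential M \<psi> N) x + defect M ?\<theta> x" for x
    using integrable_bounded_borel[OF bounded_borel_lazy_potential[OF assms, of N]] integrable_bounded_borel[OF bounded_borel_lazy_pow[OF assms, of N]]
    by (simp add: defect_def mavg_def lazy_potential_def)
  moreover have "defect M ?\<theta> x = 2 * (?\<theta> x - lazy M ?\<theta> x)" for x
    by (simp add: defect_def lazy_def scaleR_conv_of_real algebra_simps)
  ultimately show ?case unfolding Suc by (simp add: fun_eq_iff algebra_simps)
qed

lemma norm_sum_power2_le:
  fixes v :: "nat \<Rightarrow> complex"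
  assumes "\<And>n. 0 < a n"
  shows "(norm (\<Sum>n<N. v n))\<^sup>2 \<le> (\<Sum>n<N. a n) * (\<Sum>n<N. (norm (v n))\<^sup>2 / a n)"
proof -
  have "(norm (\<Sum>n<N. v n))\<^sup>2 \<le> (\<Sum>n<N. norm (v n))\<^sup>2"
    by (intro power_mono norm_sum) auto
  also have "\<dots> = (\<Sum>n<N. sqrt (a n) * (norm (v n) / sqrt (a n)))\<^sup>2"
    using assms by (simp add: less_imp_neq[symmetric])
  also have "\<dots> \<le> (\<Sum>n<N. (sqrt (a n))\<^sup>2) * (\<Sum>n<N. (norm (v n) / sqrt (a n))\<^sup>2)"
    by (rule Cauchy_Schwarz_ineq_sum)
  also have "\<dots> = (\<Sum>n<N. a n) * (\<Sum>n<N. (norm (v n))\<^sup>2 / a n)"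
    using assms by (simp add: power_divide less_imp_le)
  finally show ?thesis .
qed

lemma scale_diff3_lazy_potential: "scale_diff3 (lazy_potential M \<psi> N) x p = (\<Sum>n<N. scale_diff3 ((lazy M ^^ n) \<psi>) x p)"
  by (simp add: scale_diff3_def scale_diff_def lazy_potential_def sum_subtractf)

text \<open>
  The Cauchy-Schwarz inequality with weights \<open>a n\<close> bounds the second moment by a constant times
  \<open>\<Sum> a n\<close> times \<open>\<Sum> 1 / ((n + 1)\<^sup>3 * a n)\<close>; the exponent \<open>- 3/2\<close> makes the two sums equal and finite.
  Two differences would leave the square \<open>(n + 1)\<^sup>2\<close>, for which no weights make both sums converge.
\<close>

lemma scale_diff3_lazy_potential_L2_bounded:
  assumes b: "bounded_borel \<psi>"
  shows "\<exists>B. \<forall>N. (\<integral>p. (norm (scale_diff3 (lazy_potential M \<psi> N) x p))\<^sup>2 \<partial>((M \<Otimes>\<^sub>M M) \<Otimes>\<^sub>M M)) \<le> B"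
proof -
  interpret P: pair_prob_space M M ..
  interpret Q: pair_prob_space "M \<Otimes>\<^sub>M M" M ..
  obtain C where C: "\<And>x. norm (\<psi> x) \<le> C" using b unfolding bounded_borel_def by auto
  define a where "a n = (real n + 1) powr (- 3/2)" for n
  have a0: "0 < a n" for n by (simp add: a_def)
  have "summable (\<lambda>n. real (Suc n) powr (- 3/2))"
    by (subst summable_Suc_iff) (simp add: summable_real_powr_iff)
  moreover have "a = (\<lambda>n. real (Suc n) powr (- 3/2))" by (simp add: a_def fun_eq_iff add.commute)
  ultimately have sa: "summable a" by simp
  let ?d = "\<lambda>n p. scale_diff3 ((lazy M ^^ n) \<psi>) x p"
  let ?R = "(M \<Otimes>\<^sub>M M) \<Otimes>\<^sub>M M"
  have int: "integrable ?R (\<lambda>p. (norm (scale_diff3 \<phi> x p))\<^sup>2)" if "bounded_borel \<phi>" for \<phi>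
  proof -
    note f = bounded_family_norm2[OF bounded_family_scale_diff3[OF that]]
    obtain D where "\<And>p x. norm ((norm (scale_diff3 \<phi> x p))\<^sup>2) \<le> D" using f unfolding bounded_family_def by blast
    then show ?thesis by (intro Q.integrable_const_bound[of _ D] bounded_family_measurable[OF f]) auto
  qed
  have A: "(\<Sum>n<N. a n) \<le> suminf a" for N
    using sa a0 by (intro sum_le_suminf) (auto intro: less_imp_le)
  have "(\<integral>p. (norm (scale_diff3 (lazy_potential M \<psi> N) x p))\<^sup>2 \<partial>?R) \<le> suminf a * (1728 * C\<^sup>2 * suminf a)" for N
  proof -
    have i: "integrable ?R (\<lambda>p. (norm (?d n p))\<^sup>2)" for n by (rule int[OF bounded_borel_lazy_pow[OF b]])
    have "(\<integral>p. (norm (scale_diff3 (lazy_potential M \<psi> N) x p))\<^sup>2 \<partial>?R)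
        \<le> (\<integral>p. (\<Sum>n<N. a n) * (\<Sum>n<N. (norm (?d n p))\<^sup>2 / a n) \<partial>?R)"
      using norm_sum_power2_le[of a, OF a0] unfolding scale_diff3_lazy_potential[symmetric]
      by (intro integral_mono int[OF bounded_borel_lazy_potential[OF b]]) (auto simp: i scale_diff3_lazy_potential)
    also have "\<dots> = (\<Sum>n<N. a n) * (\<Sum>n<N. (\<integral>p. (norm (?d n p))\<^sup>2 \<partial>?R) / a n)"
      using i by simp
    also have "\<dots> \<le> (\<Sum>n<N. a n) * (\<Sum>n<N. 1728 * C\<^sup>2 * a n)"
    proof (intro mult_left_mono sum_mono sum_nonneg)
      fix n
      have "(\<integral>p. (norm (?d n p))\<^sup>2 \<partial>?R) / a n \<le> (1728 * C\<^sup>2 / (real n + 1) ^ 3) / a n"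
        using a0[of n] by (intro divide_right_mono scale_diff3_lazy_pow[OF b C]) auto
      also have "\<dots> = 1728 * C\<^sup>2 * a n"
      proof -
        have "a n * a n = (real n + 1) powr (- 3)" unfolding a_def powr_add[symmetric] by simp
        also have "\<dots> = 1 / (real n + 1) ^ 3"
          by (simp add: powr_minus_divide powr_numeral)
        finally have "1 / (real n + 1) ^ 3 / a n = a n" using a0[of n] by (simp add: field_simps)
        then show ?thesis by (metis (no_types, opaque_lifting) divide_divide_eq_left' mult.right_neutral times_divide_eq_right)
      qed
      finally show "(\<integral>p. (norm (?d n p))\<^sup>2 \<partial>?R) / a n \<le> 1728 * C\<^sup>2 * a n" .
    qed (use a0 in \<open>auto intro: less_imp_le\<close>)
    also have "\<dots> \<le> suminf a * (1728 * C\<^sup>2 * suminf a)"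
      unfolding sum_distrib_left[symmetric]
      using A[of N] a0 by (intro mult_mono) (auto intro!: sum_nonneg suminf_nonneg sa mult_nonneg_nonneg less_imp_le[OF a0])
    finally show ?thesis .
  qed
  then show ?thesis by blast
qed

text \<open>
  The hypothesis gives no control of the partial sums in the variable \<open>x\<close>, so \<open>U\<close> cannot be moved
  through the limit directly. For triple differences of the lazy sums it can, by their uniform \<open>L\<^sup>2\<close>
  bound, and this identifies \<open>(I - U)\<^sup>2 \<psi>\<close> as zero.
\<close>

lemma potential_zero_imp_zero:
  fixes \<psi> :: "real \<Rightarrow> complex"
  assumes b: "bounded_borel \<psi>" and lim: "\<And>x. (\<lambda>N. \<Sum>n<N. (mavg M ^^ n) \<psi> x) \<longlonglongrightarrow> 0"
  shows "\<psi> x = 0"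
proof -
  interpret P: pair_prob_space M M ..
  interpret Q: pair_prob_space "M \<Otimes>\<^sub>M M" M ..
  define u where "u x j n = (mavg M ^^ j) ((lazy M ^^ n) \<psi>) x" for x j n
  have u_rec: "u x j (Suc n) = (u x j n + u x (Suc j) n) / 2" for x j n
    unfolding u_def by (rule mavg_lazy_pow_rec[OF b])
  have u0: "(\<lambda>j. u x j 0) \<longlonglongrightarrow> 0" for x
  proof -
    have "(\<lambda>n. (\<Sum>n<Suc n. (mavg M ^^ n) \<psi> x) - (\<Sum>n<n. (mavg M ^^ n) \<psi> x)) \<longlonglongrightarrow> 0 - 0"
      by (intro tendsto_diff lim LIMSEQ_Suc[OF lim])
    then show ?thesis by (simp add: u_def)
  qed
  have u_null: "(\<lambda>n. u x j n) \<longlonglongrightarrow> 0" for x j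
    by (rule euler_transform_null[of "u x", OF u_rec u0])
  have S_null: "(\<lambda>N. lazy_potential M \<psi> N x) \<longlonglongrightarrow> 0" for x
    using euler_sum_null[of "u x", OF u_rec] lim[of x] by (simp add: u_def lazy_potential_def)
  \<comment> \<open>Compare two evaluations of the limit of the threefold defect of the lazy sums.\<close>
  have dd: "defect M (defect M \<psi>) x = 0" for x
  proof -
    let ?R = "(M \<Otimes>\<^sub>M M) \<Otimes>\<^sub>M M"
    obtain B where B: "\<And>N. (\<integral>p. (norm (scale_diff3 (lazy_potential M \<psi> N) x p))\<^sup>2 \<partial>?R) \<le> B"
      using scale_diff3_lazy_potential_L2_bounded[OF b] by blast
    have "(\<lambda>N. \<integral>p. scale_diff3 (lazy_potential M \<psi> N) x p \<partial>?R) \<longlonglongrightarrow> 0"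
    proof (rule Q.integral_null_if_L2_bounded[OF _ _ B])
      fix N
      note f = bounded_family_scale_diff3[OF bounded_borel_lazy_potential[OF b, of N]]
      show "scale_diff3 (lazy_potential M \<psi> N) x \<in> borel_measurable ?R"
        by (rule bounded_family_measurable[OF f]) auto
      note g = bounded_family_norm2[OF f]
      obtain D where "\<And>p x. norm ((norm (scale_diff3 (lazy_potential M \<psi> N) x p))\<^sup>2) \<le> D"
        using g unfolding bounded_family_def by blast
      then show "integrable ?R (\<lambda>p. (norm (scale_diff3 (lazy_potential M \<psi> N) x p))\<^sup>2)"
        by (intro Q.integrable_const_bound[of _ D] bounded_family_measurable[OF g]) auto
    next
      fix p
      have "(\<lambda>N. scale_diff3 (lazy_potential M \<psi> N) x p) \<longlonglongrightarrow> scale_diff3 (\<lambda>x. 0) x p"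
        unfolding scale_diff3_def scale_diff_def by (intro tendsto_diff S_null)
      then show "(\<lambda>N. scale_diff3 (lazy_potential M \<psi> N) x p) \<longlonglongrightarrow> 0" by (simp add: scale_diff3_def scale_diff_def)
    qed
    moreover have "(\<integral>p. scale_diff3 (lazy_potential M \<psi> N) x p \<partial>?R)
      = 2 * defect M (defect M \<psi>) x - 2 * (u x 0 N - 2 * u x 1 N + u x 2 N)" for N
    proof -
      let ?\<theta> = "(lazy M ^^ N) \<psi>"
      note bs = b bounded_borel_lazy_pow[OF b, of N] bounded_borel_defect bounded_borel_mavg
      have c: "defect M (\<lambda>x. 2 * (f x - g x)) = (\<lambda>x. 2 * (defect M f x - defect M g x))" if "bounded_borel f" "bounded_borel g" for f g
        using integrable_bounded_borel[OF that(1)] integrable_bounded_borel[OF that(2)] by (simp add: defect_def mavg_def fun_eq_iff algebra_simps)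
      have dd\<theta>: "defect M (defect M ?\<theta>) x = u x 0 N - 2 * u x 1 N + u x 2 N"
        using mavg_diff[OF bs(2) bounded_borel_mavg[OF bs(2)]]
        by (simp add: defect_def[abs_def] u_def numeral_2_eq_2)
      have int: "(\<integral>p. scale_diff3 (lazy_potential M \<psi> N) x p \<partial>?R) = 2 * (defect M (defect M \<psi>) x - defect M (defect M ?\<theta>) x)"
        unfolding integral_scale_diff3[OF bounded_borel_lazy_potential[OF b]] defect_lazy_potential[OF b] using bs by (simp only: c)
      show ?thesis unfolding int dd\<theta> by (simp add: algebra_simps)
    qed
    ultimately have "(\<lambda>N. 2 * defect M (defect M \<psi>) x - 2 * (u x 0 N - 2 * u x 1 N + u x 2 N)) \<longlonglongrightarrow> 0"
      by simp
    moreover have "(\<lambda>N. 2 * defect M (defect M \<psi>) x - 2 * (u x 0 N - 2 * u x 1 N + u x 2 N))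
       \<longlonglongrightarrow> 2 * defect M (defect M \<psi>) x - 2 * (0 - 2 * 0 + 0)"
      by (intro tendsto_intros u_null)
    ultimately show ?thesis using LIMSEQ_unique by fastforce
  qed
  \<comment> \<open>Cancel the two factors \<open>I - U\<close> one after the other.\<close>
  have harm: "\<theta> x = 0" if "bounded_borel \<theta>" "\<And>x. defect M \<theta> x = 0" "(\<lambda>n. (mavg M ^^ n) \<theta> x) \<longlonglongrightarrow> 0" for \<theta> x
  proof -
    have "mavg M \<theta> = \<theta>" using that(2) by (auto simp: defect_def fun_eq_iff)
    then have "(mavg M ^^ n) \<theta> = \<theta>" for n by (induction n) auto
    with that(3) show ?thesis by (simp add: LIMSEQ_const_iff)
  qed
  have "defect M \<psi> x = 0" for x
  proof (rule harm[OF bounded_borel_defect[OF b] dd])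
    have "(mavg M ^^ n) (defect M \<psi>) x = u x n 0 - u x (Suc n) 0" for n
      unfolding mavg_pow_defect[OF b] by (simp add: u_def)
    moreover have "(\<lambda>n. u x n 0 - u x (Suc n) 0) \<longlonglongrightarrow> 0 - 0"
      by (intro tendsto_diff u0 LIMSEQ_Suc[OF u0])
    ultimately show "(\<lambda>n. (mavg M ^^ n) (defect M \<psi>) x) \<longlonglongrightarrow> 0" by simp
  qed
  then show ?thesis using harm[OF b, of x] u0[of x] by (simp add: u_def)
qed

end

section \<open>Products of independent random factors\<close>

context prob_space
begin

lemma prob_space_countable_power: "prob_space (countable_power M)"
  unfolding countable_power_def by (intro prob_space_PiM prob_space_axioms)

lemma coordinate_distr: "distr (countable_power M) M (\<lambda>w. w i) = M"
  unfolding countable_power_def by (rule distr_PiM_component) (auto intro: prob_space_axioms)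

lemma coordinate_measurable [measurable]: "(\<lambda>w. w i) \<in> measurable (countable_power M) M"
  unfolding countable_power_def by simp

lemma AE_coordinate:
  assumes "AE x in M. Q x" shows "AE w in countable_power M. Q (w i)"
  using assms unfolding countable_power_def
  by (intro AE_PiM_component) (auto intro: prob_space_axioms)

lemma integrable_coordinate:
  fixes f :: "'a \<Rightarrow> 'b::{banach, second_countable_topology}"
  assumes "integrable M f" shows "integrable (countable_power M) (\<lambda>w. f (w i))"
  by (rule integrable_distr[OF coordinate_measurable]) (simp add: coordinate_distr assms)

lemma integral_coordinate:
  fixes f :: "'a \<Rightarrow> 'b::{banach, second_countable_topology}"
  assumes "f \<in> borel_measurable M"
  shows "(\<integral>w. f (w i) \<partial>countable_power M) = (\<integral>x. f x \<partial>M)"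
  using integral_distr[OF coordinate_measurable[of i] assms] by (simp add: coordinate_distr)

lemma indep_coordinates:
  fixes f :: "'a \<Rightarrow> real"
  assumes [measurable]: "f \<in> borel_measurable M"
  shows "prob_space.indep_vars (countable_power M) (\<lambda>_. borel) (\<lambda>i w. f (w i)) (I :: nat set)"
proof -
  interpret S: prob_space "countable_power M" by (rule prob_space_countable_power)
  have "S.indep_vars (\<lambda>_. M) (\<lambda>i w. w i) (UNIV :: nat set)"
  proof (subst S.indep_vars_iff_distr_eq_PiM')
    have "distr (countable_power M) (Pi\<^sub>M UNIV (\<lambda>i. M)) (\<lambda>x. restrict x UNIV) = countable_power M"
      unfolding restrict_UNIV countable_power_def by (rule distr_id)
    also have "\<dots> = Pi\<^sub>M UNIV (\<lambda>i. distr (countable_power M) M (\<lambda>w. w i))"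
      unfolding coordinate_distr by (simp add: countable_power_def)
    finally show "distr (countable_power M) (Pi\<^sub>M UNIV (\<lambda>i. M)) (\<lambda>x. \<lambda>i\<in>UNIV. x i) =
       Pi\<^sub>M UNIV (\<lambda>i. distr (countable_power M) M (\<lambda>w. w i))" by simp
  qed auto
  then have "S.indep_vars (\<lambda>_. borel) (\<lambda>i w. f (w i)) UNIV"
    by (rule S.indep_vars_compose2) auto
  then show ?thesis by (rule S.indep_vars_subset) auto
qed

text \<open>
  Hoeffding's inequality for independent variables in \<open>[-c, c]\<close>.
\<close>

lemma bounded_walk_lower_tail:
  fixes T :: "'a \<Rightarrow> real"
  assumes [measurable]: "T \<in> borel_measurable M" and T: "\<And>x. \<bar>T x\<bar> \<le> c" and "c > 0" "e > 0"
  shows "(\<lambda>n. measure (countable_power M)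
      {w \<in> space (countable_power M). (\<Sum>i<n. T (w i)) \<le> real n * (expectation T - e)}) \<longlonglongrightarrow> 0"
proof -
  interpret S: prob_space "countable_power M" by (rule prob_space_countable_power)
  have "(\<lambda>n. exp (- (e\<^sup>2 / (2 * c\<^sup>2)) * real n)) = (\<lambda>n. exp (- (e\<^sup>2 / (2 * c\<^sup>2))) ^ n)"
    by (simp add: exp_of_nat_mult[symmetric] fun_eq_iff mult.commute)
  moreover have "(\<lambda>n. exp (- (e\<^sup>2 / (2 * c\<^sup>2))) ^ n) \<longlonglongrightarrow> 0"
    using \<open>c > 0\<close> \<open>e > 0\<close> by (intro LIMSEQ_power_zero) auto
  ultimately have lim: "(\<lambda>n. exp (- (e\<^sup>2 / (2 * c\<^sup>2)) * real n)) \<longlonglongrightarrow> 0" by simp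
  show ?thesis
  proof (rule tendsto_sandwich[OF _ _ tendsto_const lim])
    show "\<forall>\<^sub>F n in sequentially. measure (countable_power M)
        {w \<in> space (countable_power M). (\<Sum>i<n. T (w i)) \<le> real n * (expectation T - e)}
      \<le> exp (- (e\<^sup>2 / (2 * c\<^sup>2)) * real n)"
    proof (rule eventually_mono[OF eventually_gt_at_top[of 0]])
      fix n :: nat assume "n > 0"
      interpret H: Hoeffding_ineq "countable_power M" "{..<n}" "\<lambda>i w. T (w i)" "\<lambda>_. -c" "\<lambda>_. c"
        "\<Sum>i<n. S.expectation (\<lambda>w. T (w i))"
      proof unfold_locales
        show "S.indep_vars (\<lambda>_. borel) (\<lambda>i w. T (w i)) {..<n}"
          by (rule indep_coordinates) simp
        show "AE w in countable_power M. T (w i) \<in> {- c..c}" for i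
          using T by (intro AE_I2) (simp add: abs_le_iff minus_le_iff)
      qed auto
      have "(\<Sum>i<n. S.expectation (\<lambda>w. T (w i))) - real n * e = real n * (expectation T - e)"
        by (simp add: integral_coordinate algebra_simps)
      moreover have "- 2 * (real n * e)\<^sup>2 / (\<Sum>i<n. (c - - c)\<^sup>2) = - (e\<^sup>2 / (2 * c\<^sup>2)) * real n"
        using \<open>n > 0\<close> \<open>c > 0\<close> by (simp add: field_simps power2_eq_square)
      moreover have "(\<Sum>i<n. (c - - c)\<^sup>2) > 0" using \<open>n > 0\<close> \<open>c > 0\<close> by simp
      ultimately show "measure (countable_power M)
        {w \<in> space (countable_power M). (\<Sum>i<n. T (w i)) \<le> real n * (expectation T - e)}
      \<le> exp (- (e\<^sup>2 / (2 * c\<^sup>2)) * real n)"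
        using H.Hoeffding_ineq_le[of "real n * e"] \<open>e > 0\<close> by simp
    qed
  qed (simp add: always_eventually)
qed

text \<open>
  Only the first moment of \<open>Z\<close> is available, so \<open>Z\<close> is truncated at a height \<open>c\<close> where the mean of the
  truncation \<open>T\<close> still exceeds half of the mean \<open>m\<close> of \<open>Z\<close>. The sum of the \<open>T\<close> grows like
  \<open>n\<close> times its mean by Hoeffding's inequality. What the truncation removes on the negative side, \<open>N\<close>, has a mean so
  small that by Markov's inequality its sum rarely reaches \<open>n * m / 4\<close>. Truncation on the positive
  side only lowers the sum.
\<close>

lemma walk_tends_to_infinity:
  fixes Z :: "'a \<Rightarrow> real"
  assumes Z: "integrable M Z" and pos: "0 < expectation Z"
  shows "(\<lambda>n. measure (countable_power M)
      {w \<in> space (countable_power M). (\<Sum>i<n. Z (w i)) \<le> K}) \<longlonglongrightarrow> 0"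
proof (rule LIMSEQ_I)
  fix r :: real assume "r > 0"
  interpret S: prob_space "countable_power M" by (rule prob_space_countable_power)
  have [measurable]: "Z \<in> borel_measurable M" using Z by auto
  define m where "m = expectation Z"
  have "m > 0" using pos by (simp add: m_def)
  define T where "T c x = max (- c) (min (Z x) c)" for c x
  define N where "N c x = max 0 (- Z x - c)" for c x
  have Tm [measurable]: "T c \<in> borel_measurable M" and Nm [measurable]: "N c \<in> borel_measurable M" for c
    unfolding T_def N_def by measurable
  have TN: "T c x - N c x \<le> Z x" if "c \<ge> 0" for c x
    using that unfolding T_def N_def by (auto simp: max_def min_def)
  have "(\<lambda>k. expectation (T (real k))) \<longlonglongrightarrow> expectation Z"
  proof (rule integral_dominated_convergence[where w = "\<lambda>x. \<bar>Z x\<bar>"])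
    show "AE x in M. (\<lambda>k. T (real k) x) \<longlonglongrightarrow> Z x"
    proof (intro AE_I2 tendsto_eventually)
      fix x
      obtain k0 :: nat where "\<bar>Z x\<bar> \<le> real k0" using real_arch_simple by blast
      then show "\<forall>\<^sub>F k in sequentially. T (real k) x = Z x"
        unfolding T_def eventually_sequentially by (intro exI[of _ k0]) (auto simp: max_def min_def)
    qed
  qed (use Z in \<open>auto simp: T_def max_def min_def\<close>)
  moreover have "(\<lambda>k. expectation (N (real k))) \<longlonglongrightarrow> expectation (\<lambda>x. 0)"
  proof (rule integral_dominated_convergence[where w = "\<lambda>x. \<bar>Z x\<bar>"])
    show "AE x in M. (\<lambda>k. N (real k) x) \<longlonglongrightarrow> 0"
    proof (intro AE_I2 tendsto_eventually)
      fix x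
      obtain k0 :: nat where "\<bar>Z x\<bar> \<le> real k0" using real_arch_simple by blast
      then show "\<forall>\<^sub>F k in sequentially. N (real k) x = 0"
        unfolding N_def eventually_sequentially by (intro exI[of _ k0]) (auto simp: max_def)
    qed
  qed (use Z in \<open>auto simp: N_def max_def\<close>)
  ultimately have "\<forall>\<^sub>F k in sequentially. m / 2 < expectation (T (real k)) \<and> expectation (N (real k)) < r * m / 16 \<and> k > 0"
    using \<open>m > 0\<close> \<open>r > 0\<close>
    by (intro eventually_conj order_tendstoD eventually_gt_at_top) (auto simp: m_def[symmetric])
  then obtain k where k: "m / 2 < expectation (T (real k))" "expectation (N (real k)) < r * m / 16" "k > 0"
    by (auto dest: eventually_happens)
  define c where "c = real k"
  have c: "c > 0" "m / 2 < expectation (T c)" "expectation (N c) < r * m / 16"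
    unfolding c_def using k by simp_all
  have intN: "integrable M (N c)"
    using c by (intro Bochner_Integration.integrable_bound[OF Z]) (auto simp: N_def max_def)
  let ?A = "\<lambda>n. {w \<in> space (countable_power M). (\<Sum>i<n. T c (w i)) \<le> real n * (expectation (T c) - m/8)}"
  let ?B = "\<lambda>n. {w \<in> space (countable_power M). (\<Sum>i<n. N c (w i)) \<ge> real n * m / 4}"
  let ?C = "\<lambda>n. {w \<in> space (countable_power M). (\<Sum>i<n. Z (w i)) \<le> K}"
  have "(\<lambda>n. measure (countable_power M) (?A n)) \<longlonglongrightarrow> 0"
    using c \<open>m > 0\<close> by (intro bounded_walk_lower_tail[of _ c]) (auto simp: T_def)
  then have "\<forall>\<^sub>F n in sequentially. measure (countable_power M) (?A n) < r / 2"
    using \<open>r > 0\<close> by (intro order_tendstoD) auto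
  moreover have "\<forall>\<^sub>F n in sequentially. K \<le> real n * (m / 8)"
  proof -
    obtain n0 :: nat where n0: "K / (m / 8) \<le> real n0" using real_arch_simple by blast
    have "K \<le> real n * (m / 8)" if "n \<ge> n0" for n
    proof -
      have "K / (m / 8) \<le> real n" using n0 that by linarith
      then show ?thesis using \<open>m > 0\<close> by (simp add: field_simps)
    qed
    then show ?thesis unfolding eventually_sequentially by blast
  qed
  moreover have "\<forall>\<^sub>F n::nat in sequentially. n > 0" by (rule eventually_gt_at_top)
  ultimately have "\<forall>\<^sub>F n in sequentially. measure (countable_power M) (?C n) < r"
  proof eventually_elim
    case (elim n)
    \<comment> \<open>Outside \<open>?B n\<close> the sum of the \<open>T\<close> is at most \<open>K + n * m / 4 \<le> n * (3 * m / 8)\<close>, and \<open>3 * m / 8\<close> lies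
      below the mean of \<open>T\<close> by at least \<open>m / 8\<close>.\<close>
    have "?C n \<subseteq> ?A n \<union> ?B n"
    proof
      fix w assume w: "w \<in> ?C n"
      have "(\<Sum>i<n. T c (w i)) - (\<Sum>i<n. N c (w i)) \<le> (\<Sum>i<n. Z (w i))"
        unfolding sum_subtractf[symmetric] using c by (intro sum_mono TN) simp
      moreover have "real n * (m / 2) \<le> real n * expectation (T c)"
        using c by (intro mult_left_mono) auto
      moreover have "real n * (expectation (T c) - m/8) = real n * expectation (T c) - real n * (m / 8)"
        "real n * (m / 2) = real n * m / 2" "real n * (m / 8) = real n * m / 8"
        by (simp_all add: algebra_simps)
      ultimately show "w \<in> ?A n \<union> ?B n" using w elim(2) by (cases "w \<in> ?B n") auto
    qed
    then have "measure (countable_power M) (?C n) \<le> measure (countable_power M) (?A n \<union> ?B n)"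
      by (intro S.finite_measure_mono) auto
    also have "\<dots> \<le> measure (countable_power M) (?A n) + measure (countable_power M) (?B n)"
      by (intro measure_Un_le) auto
    also have "measure (countable_power M) (?B n) \<le> S.expectation (\<lambda>w. \<Sum>i<n. N c (w i)) / (real n * m / 4)"
      using elim(3) \<open>m > 0\<close>
      by (intro integral_Markov_inequality_measure[where A = "space (countable_power M)"])
         (auto intro!: integrable_coordinate intN sum_nonneg AE_I2, auto simp: N_def intro!: sum_nonneg)
    also have "S.expectation (\<lambda>w. \<Sum>i<n. N c (w i)) = real n * expectation (N c)"
      by (simp add: integrable_coordinate intN integral_coordinate)
    also have "real n * expectation (N c) / (real n * m / 4) = 4 * expectation (N c) / m"
      using elim(3) by (simp add: field_simps)
    also have "\<dots> < r / 4" using c \<open>m > 0\<close> by (simp add: field_simps)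
    finally show ?case using elim(1) \<open>r > 0\<close> by simp
  qed
  then show "\<exists>no. \<forall>n\<ge>no. norm (measure (countable_power M) (?C n) - 0) < r"
    unfolding eventually_sequentially by simp
qed

definition inv_law :: "('a \<Rightarrow> real) \<Rightarrow> real measure" where
  "inv_law L = distr M borel (\<lambda>\<omega>. inverse (L \<omega>))"

lemma real_distribution_inv_law: "L \<in> borel_measurable M \<Longrightarrow> real_distribution (inv_law L)"
  unfolding inv_law_def by (intro real_distribution_distr) simp

lemma mavg_inv_law:
  fixes \<phi> :: "real \<Rightarrow> complex"
  assumes "L \<in> borel_measurable M" "bounded_borel \<phi>"
  shows "mavg (inv_law L) \<phi> x = (\<integral>\<omega>. \<phi> (x / L \<omega>) \<partial>M)"
  unfolding mavg_def inv_law_def using assms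
  by (subst integral_distr) (auto simp: bounded_borel_def divide_inverse)

text \<open>
  Splitting off the first coordinate of the infinite product. Points where a factor \<open>L\<close> vanishes need no
  separate treatment: \<open>x / (a * b) = x / a / b\<close> holds for all reals because \<open>x / 0 = 0\<close>.
\<close>

lemma mavg_pow_inv_law:
  fixes \<phi> :: "real \<Rightarrow> complex"
  assumes L [measurable]: "L \<in> borel_measurable M" and b: "bounded_borel \<phi>"
  shows "(mavg (inv_law L) ^^ n) \<phi> x = (\<integral>w. \<phi> (x / (\<Prod>j<n. L (w j))) \<partial>countable_power M)"
proof (induction n arbitrary: x)
  case 0
  interpret S: prob_space "countable_power M" by (rule prob_space_countable_power)
  show ?case by (simp add: S.prob_space)
next
  case (Suc n)
  interpret R: real_distribution "inv_law L" by (rule real_distribution_inv_law[OF L])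
  interpret S: prob_space "countable_power M" by (rule prob_space_countable_power)
  interpret Q: sequence_space M ..
  interpret P: pair_prob_space M "countable_power M" ..
  have [measurable]: "\<phi> \<in> borel_measurable borel" using b by (rule bounded_borel_measurable)
  obtain C where C: "\<And>x. norm (\<phi> x) \<le> C" using b unfolding bounded_borel_def by auto
  let ?F = "\<lambda>w. \<phi> (x / (\<Prod>j<Suc n. L (w j)))"
  have iter: "countable_power M = distr (M \<Otimes>\<^sub>M countable_power M) (countable_power M) (\<lambda>(s, w). case_nat s w)"
    using Q.PiM_iter unfolding countable_power_def by simp
  have cm: "(\<lambda>(s, w). case_nat s w) \<in> measurable (M \<Otimes>\<^sub>M countable_power M) (countable_power M)"
    unfolding countable_power_def by measurable
  have "(\<integral>w. ?F w \<partial>countable_power M) = (\<integral>p. ?F (case_nat (fst p) (snd p)) \<partial>(M \<Otimes>\<^sub>M countable_power M))"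
    by (subst iter, subst integral_distr[OF cm]) (auto simp: case_prod_beta)
  also have "\<dots> = (\<integral>p. \<phi> (x / L (fst p) / (\<Prod>j<n. L (snd p j))) \<partial>(M \<Otimes>\<^sub>M countable_power M))"
    by (simp add: prod.lessThan_Suc_shift del: prod.lessThan_Suc)
  also have "\<dots> = (\<integral>s. \<integral>w. \<phi> (x / L s / (\<Prod>j<n. L (w j))) \<partial>countable_power M \<partial>M)"
  proof (subst P.integral_fst'[symmetric])
    show "integrable (M \<Otimes>\<^sub>M countable_power M) (\<lambda>p. \<phi> (x / L (fst p) / (\<Prod>j<n. L (snd p j))))"
      using C by (intro P.integrable_const_bound[of _ C]) auto
  qed simp
  also have "\<dots> = (\<integral>s. (mavg (inv_law L) ^^ n) \<phi> (x / L s) \<partial>M)"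
    by (simp add: Suc)
  also have "\<dots> = (mavg (inv_law L) ^^ Suc n) \<phi> x"
    by (simp add: mavg_inv_law[OF L R.bounded_borel_mavg_pow[OF b]])
  finally show ?case by simp
qed

text \<open>
  The random points \<open>x / (L\<^sub>1 \<cdots> L\<^sub>n)\<close> tend to 0 in probability, and \<open>\<phi>\<close> is bounded and continuous at 0.
\<close>

lemma mavg_pow_tendsto:
  fixes \<phi> :: "real \<Rightarrow> complex"
  assumes L [measurable]: "L \<in> borel_measurable M" and b: "bounded_borel \<phi>" and cont: "isCont \<phi> 0"
    and int: "integrable M (\<lambda>\<omega>. ln \<bar>L \<omega>\<bar>)" and pos: "0 < expectation (\<lambda>\<omega>. ln \<bar>L \<omega>\<bar>)"
  shows "(\<lambda>n. (mavg (inv_law L) ^^ n) \<phi> x) \<longlonglongrightarrow> \<phi> 0"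
proof (rule LIMSEQ_I)
  fix r :: real assume "r > 0"
  interpret S: prob_space "countable_power M" by (rule prob_space_countable_power)
  have [measurable]: "\<phi> \<in> borel_measurable borel" using b by (rule bounded_borel_measurable)
  obtain C where C: "\<And>x. norm (\<phi> x) \<le> C" using b unfolding bounded_borel_def by auto
  have C0: "C \<ge> 0" using C[of 0] norm_ge_zero order_trans by blast
  obtain d where d: "d > 0" "\<And>y. \<bar>y\<bar> < d \<Longrightarrow> norm (\<phi> y - \<phi> 0) < r / 2"
    using cont \<open>r > 0\<close> unfolding continuous_at_eps_delta
    by (metis diff_zero dist_norm half_gt_zero real_norm_def)
  define K where "K = ln \<bar>x\<bar> - ln d"
  let ?X = "\<lambda>n w. x / (\<Prod>j<n. L (w j))"
  let ?E = "\<lambda>n. {w \<in> space (countable_power M). (\<Sum>i<n. ln \<bar>L (w i)\<bar>) \<le> K}"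
  have out: "w \<in> ?E n" if "w \<in> space (countable_power M)" "\<bar>?X n w\<bar> \<ge> d" for w n
  proof -
    have nz: "x \<noteq> 0" "(\<Prod>j<n. L (w j)) \<noteq> 0"
      using that(2) d(1) by (metis abs_zero div_0 not_less, metis abs_zero div_by_0 not_less)
    have "\<And>j. j < n \<Longrightarrow> L (w j) \<noteq> 0" using nz(2) by simp
    then have "ln \<bar>\<Prod>j<n. L (w j)\<bar> = (\<Sum>i<n. ln \<bar>L (w i)\<bar>)"
      unfolding abs_prod by (subst ln_prod) auto
    moreover have "ln d \<le> ln \<bar>?X n w\<bar>" using that(2) d(1) by (subst ln_le_cancel_iff) auto
    moreover have "ln \<bar>?X n w\<bar> = ln \<bar>x\<bar> - ln \<bar>\<Prod>j<n. L (w j)\<bar>"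
      using nz by (simp add: ln_div del: abs_prod)
    ultimately show ?thesis using that(1) by (simp add: K_def)
  qed
  have "(\<lambda>n. 2 * C * measure (countable_power M) (?E n)) \<longlonglongrightarrow> 2 * C * 0"
    by (intro tendsto_intros walk_tends_to_infinity[OF int pos])
  then have "\<forall>\<^sub>F n in sequentially. 2 * C * measure (countable_power M) (?E n) < r / 2"
    using \<open>r > 0\<close> by (intro order_tendstoD) auto
  then have "\<forall>\<^sub>F n in sequentially. norm ((mavg (inv_law L) ^^ n) \<phi> x - \<phi> 0) < r"
  proof eventually_elim
    case (elim n)
    have i1: "integrable (countable_power M) (\<lambda>w. \<phi> (?X n w))"
      using C by (intro S.integrable_const_bound[of _ C]) auto
    have i2: "integrable (countable_power M) (\<lambda>w. r / 2 + 2 * C * indicator (?E n) w)"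
      by (intro Bochner_Integration.integrable_add integrable_mult_right) (auto simp: integrable_indicator_iff S.emeasure_eq_measure)
    have "norm ((mavg (inv_law L) ^^ n) \<phi> x - \<phi> 0) = norm (\<integral>w. \<phi> (?X n w) - \<phi> 0 \<partial>countable_power M)"
      unfolding mavg_pow_inv_law[OF L b] using i1 by (simp add: S.prob_space)
    also have "\<dots> \<le> (\<integral>w. norm (\<phi> (?X n w) - \<phi> 0) \<partial>countable_power M)" by simp
    also have "\<dots> \<le> (\<integral>w. r / 2 + 2 * C * indicator (?E n) w \<partial>countable_power M)"
    proof (rule integral_mono)
      show "integrable (countable_power M) (\<lambda>w. norm (\<phi> (?X n w) - \<phi> 0))"
        using i1 by (intro integrable_norm Bochner_Integration.integrable_diff) auto
      fix w assume w: "w \<in> space (countable_power M)"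
      show "norm (\<phi> (?X n w) - \<phi> 0) \<le> r / 2 + 2 * C * indicator (?E n) w"
      proof (cases "\<bar>?X n w\<bar> < d")
        case True
        then have "norm (\<phi> (?X n w) - \<phi> 0) < r / 2" by (rule d(2))
        then show ?thesis using C0 by (simp add: add_increasing2 less_imp_le)
      next
        case False
        then have "w \<in> ?E n" using out[OF w, of n] by linarith
        moreover have "norm (\<phi> (?X n w) - \<phi> 0) \<le> C + C"
          by (intro order_trans[OF norm_triangle_ineq4] add_mono C)
        ultimately show ?thesis using \<open>r > 0\<close> by simp
      qed
    qed (rule i2)
    also have "\<dots> = r / 2 + 2 * C * measure (countable_power M) (?E n)"
    proof -
      have "integrable (countable_power M) (\<lambda>w. 2 * C * indicator (?E n) w)"
        by (intro integrable_mult_right) (auto simp: integrable_indicator_iff S.emeasure_eq_measure)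
      then show ?thesis by (simp add: S.prob_space)
    qed
    finally show ?case using elim by linarith
  qed
  then show "\<exists>no. \<forall>n\<ge>no. norm ((mavg (inv_law L) ^^ n) \<phi> x - \<phi> 0) < r"
    unfolding eventually_sequentially .
qed

end

section \<open>Fourier transforms of integrable functions\<close>

lemma lebesgue_measurableI: "f \<in> borel_measurable borel \<Longrightarrow> f \<in> borel_measurable lebesgue"
  by (rule measurable_completion) simp

lemma (in complete_measure) measurable_if_AE_eq:
  assumes g: "g \<in> measurable M N" and eq: "AE x in M. f x = g x" and f: "\<And>x. x \<in> space M \<Longrightarrow> f x \<in> space N"
  shows "f \<in> measurable M N"
proof (rule measurableI[OF f])
  fix A assume "A \<in> sets N"
  with g have "g -` A \<inter> space M \<in> sets M" by (rule measurable_sets)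
  then show "f -` A \<inter> space M \<in> sets M"
    by (rule in_sets_AE[rotated]) (use eq in \<open>auto elim!: eventually_mono\<close>)
qed

text \<open>
  Integrands such as \<open>f (L \<omega> * t)\<close> are jointly measurable in \<open>\<omega>\<close> and \<open>t\<close> for Borel functions, but not for
  all Lebesgue measurable ones; exchanges of integrals are carried out for this representative.
\<close>

lemma L1_borel_representative:
  assumes "h \<in> L1"
  obtains k where "k \<in> borel_measurable borel" "integrable lborel k" "k \<in> L1" "AE x in lebesgue. h x = k x"
proof -
  have int: "integrable lebesgue h" using assms by (simp add: L1_def)
  then have [measurable]: "h \<in> borel_measurable lebesgue" by auto
  obtain a where a: "a \<in> borel_measurable lborel" "AE x in lborel. Re (h x) = a x"
    using completion_ex_borel_measurable_real[of "\<lambda>x. Re (h x)" lborel] by auto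
  obtain b where b: "b \<in> borel_measurable lborel" "AE x in lborel. Im (h x) = b x"
    using completion_ex_borel_measurable_real[of "\<lambda>x. Im (h x)" lborel] by auto
  define k where "k x = Complex (a x) (b x)" for x
  have k_alt: "k = (\<lambda>x. complex_of_real (a x) + \<i> * complex_of_real (b x))"
    by (simp add: k_def fun_eq_iff complex_eq_iff)
  have k: "k \<in> borel_measurable borel"
    unfolding k_alt using a(1) b(1) by simp
  have eq: "AE x in lebesgue. h x = k x"
    unfolding AE_completion_iff using a(2) b(2) by eventually_elim (simp add: k_def complex_eq_iff)
  have intk: "integrable lebesgue k"
    using int integrable_cong_AE[OF _ lebesgue_measurableI[OF k] eq] by simp
  then have "integrable lborel k" using k by (simp add: integrable_completion)
  with k eq intk show thesis by (intro that[of k]) (auto simp: L1_def)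
qed

lemma fourier_kernel_measurable [measurable]:
  "(\<lambda>t. exp (\<i> * of_real t * of_real x :: complex)) \<in> borel_measurable lebesgue"
  by (rule lebesgue_measurableI) measurable

lemma norm_fourier_kernel: "norm (exp (\<i> * of_real t * of_real x :: complex)) = 1"
  using norm_exp_i_times[of "t * x"] by (simp add: mult.assoc)

lemma integrable_fourier:
  assumes "integrable lebesgue h"
  shows "integrable lebesgue (\<lambda>t. exp (\<i> * of_real t * of_real x) * h t)"
  using assms
  by (rule Bochner_Integration.integrable_bound) (use assms in \<open>auto simp: norm_mult norm_fourier_kernel\<close>)

lemma fourier_cong_AE:
  assumes "h \<in> L1" "k \<in> L1" "AE x in lebesgue. h x = k x"
  shows "fourier h = fourier k"
proof
  fix x
  have "h \<in> borel_measurable lebesgue" "k \<in> borel_measurable lebesgue" using assms by (auto simp: L1_def)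
  then show "fourier h x = fourier k x"
    unfolding fourier_def by (intro integral_cong_AE) (use assms(3) in \<open>auto elim!: eventually_mono\<close>)
qed

lemma fourier_lborel:
  assumes "k \<in> borel_measurable borel"
  shows "fourier k x = (\<integral>t. exp (\<i> * of_real t * of_real x) * k t \<partial>lborel)"
  unfolding fourier_def using assms by (intro integral_completion) simp

lemma fourier_diff:
  assumes "h \<in> L1" "k \<in> L1"
  shows "fourier (\<lambda>t. h t - k t) x = fourier h x - fourier k x"
  using integrable_fourier[of h x] integrable_fourier[of k x] assms
  by (simp add: fourier_def L1_def right_diff_distrib)

lemma fourier_add:
  assumes "h \<in> L1" "k \<in> L1"
  shows "fourier (\<lambda>t. h t + k t) x = fourier h x + fourier k x"
  using integrable_fourier[of h x] integrable_fourier[of k x] assms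
  by (simp add: fourier_def L1_def distrib_left)

lemma norm_fourier_le:
  assumes "h \<in> L1" shows "norm (fourier h x) \<le> (\<integral>t. norm (h t) \<partial>lebesgue)"
proof -
  have "norm (fourier h x) \<le> (\<integral>t. norm (exp (\<i> * of_real t * of_real x) * h t) \<partial>lebesgue)"
    unfolding fourier_def by (rule integral_norm_bound)
  then show ?thesis by (simp add: norm_mult norm_fourier_kernel)
qed

lemma isCont_fourier:
  assumes "h \<in> L1" shows "isCont (fourier h) x"
  unfolding continuous_at_sequentially
proof (intro allI impI)
  fix X assume X: "X \<longlonglongrightarrow> x"
  have int: "integrable lebesgue h" using assms by (simp add: L1_def)
  then have [measurable]: "h \<in> borel_measurable lebesgue" by auto
  have "(\<lambda>n. \<integral>t. exp (\<i> * of_real t * of_real (X n)) * h t \<partial>lebesgue)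
      \<longlonglongrightarrow> (\<integral>t. exp (\<i> * of_real t * of_real x) * h t \<partial>lebesgue)"
  proof (rule integral_dominated_convergence[where w = "\<lambda>t. norm (h t)"])
    show "AE t in lebesgue. (\<lambda>n. exp (\<i> * of_real t * of_real (X n)) * h t)
        \<longlonglongrightarrow> exp (\<i> * of_real t * of_real x) * h t"
      by (intro AE_I2 tendsto_intros X)
  qed (use int in \<open>auto simp: norm_mult norm_fourier_kernel\<close>)
  then show "(fourier h \<circ> X) \<longlonglongrightarrow> fourier h x"
    by (simp add: fourier_def comp_def)
qed

lemma bounded_borel_fourier:
  assumes "h \<in> L1" shows "bounded_borel (fourier h)"
  unfolding bounded_borel_def
  using norm_fourier_le[OF assms] isCont_fourier[OF assms]
  by (auto intro!: borel_measurable_continuous_onI continuous_at_imp_continuous_on)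

text \<open>
  The positive and the negative part of \<open>a\<close> have the same Fourier transform, hence the same integral \<open>c\<close>.
  After division by \<open>c\<close> they are densities of probability measures with equal characteristic functions,
  and Levy's uniqueness theorem applies.
\<close>

lemma real_fourier_unique:
  fixes a :: "real \<Rightarrow> real"
  assumes int: "integrable lborel a"
    and zero: "\<And>x. (\<integral>t. iexp (x * t) * of_real (a t) \<partial>lborel) = 0"
  shows "AE t in lborel. a t = 0"
proof -
  have [measurable]: "a \<in> borel_measurable borel" using int by auto
  define p q where "p t = max (a t) 0" and "q t = max (- a t) 0" for t
  have pm [measurable]: "p \<in> borel_measurable borel" and qm [measurable]: "q \<in> borel_measurable borel"
    unfolding p_def q_def by measurable
  have pq: "a t = p t - q t" "0 \<le> p t" "0 \<le> q t" for t by (auto simp: p_def q_def)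
  have ip: "integrable lborel p" and iq: "integrable lborel q"
    by (intro Bochner_Integration.integrable_bound[OF int]; auto simp: p_def q_def)+
  have ie: "integrable lborel (\<lambda>t. iexp (x * t) * of_real (f t))" if "integrable lborel f" for f :: "real \<Rightarrow> real" and x
    using that by (rule Bochner_Integration.integrable_bound) (use that in \<open>auto simp: norm_mult\<close>)
  have eq: "(\<integral>t. iexp (x * t) * of_real (p t) \<partial>lborel) = (\<integral>t. iexp (x * t) * of_real (q t) \<partial>lborel)" for x
    using zero[of x] ie[OF ip, of x] ie[OF iq, of x] by (simp add: pq(1) right_diff_distrib)
  define c where "c = (\<integral>t. p t \<partial>lborel)"
  have c': "c = (\<integral>t. q t \<partial>lborel)"
    using eq[of 0] by (simp add: c_def)
  have "AE t in lborel. p t = q t"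
  proof (cases "c = 0")
    case True
    have "AE t in lborel. p t = 0"
      using integral_nonneg_eq_0_iff_AE[OF ip] pq True by (simp add: c_def)
    moreover have "AE t in lborel. q t = 0"
      using integral_nonneg_eq_0_iff_AE[OF iq] pq True by (simp add: c')
    ultimately show ?thesis by eventually_elim simp
  next
    case False
    have "c \<ge> 0" unfolding c_def by (simp add: pq)
    with False have "c > 0" by simp
    have rd: "real_distribution (density lborel (\<lambda>t. f t / c))"
      if f: "integrable lborel f" "\<And>t. 0 \<le> f t" "c = (\<integral>t. f t \<partial>lborel)" for f :: "real \<Rightarrow> real"
    proof -
      have "emeasure (density lborel (\<lambda>t. f t / c)) (space lborel) = (\<integral>\<^sup>+t. ennreal (f t / c) \<partial>lborel)"
        using f(1) by (subst emeasure_density) auto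
      also have "\<dots> = ennreal (\<integral>t. f t / c \<partial>lborel)"
        using f \<open>c > 0\<close> by (intro nn_integral_eq_integral) auto
      also have "\<dots> = 1" using f(3) \<open>c > 0\<close> by simp
      finally have "prob_space (density lborel (\<lambda>t. f t / c))" by (intro prob_spaceI) simp
      then show ?thesis
        unfolding real_distribution_def real_distribution_axioms_def by simp
    qed
    have ch: "char (density lborel (\<lambda>t. f t / c)) x = (\<integral>t. iexp (x * t) * of_real (f t) \<partial>lborel) / c"
      if f: "integrable lborel f" "\<And>t. 0 \<le> f t" for f :: "real \<Rightarrow> real" and x
    proof -
      have "char (density lborel (\<lambda>t. f t / c)) x = (\<integral>t. (f t / c) *\<^sub>R iexp (x * t) \<partial>lborel)"
        unfolding char_def using f \<open>c > 0\<close> by (intro integral_density) auto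
      also have "\<dots> = (\<integral>t. iexp (x * t) * of_real (f t) / c \<partial>lborel)"
        by (intro Bochner_Integration.integral_cong refl) (simp add: scaleR_conv_of_real)
      finally show ?thesis by simp
    qed
    have "density lborel (\<lambda>t. p t / c) = density lborel (\<lambda>t. q t / c)"
    proof (rule Levy_uniqueness)
      show "real_distribution (density lborel (\<lambda>t. p t / c))" by (rule rd[OF ip pq(2) c_def])
      show "real_distribution (density lborel (\<lambda>t. q t / c))" by (rule rd[OF iq pq(3) c'])
      show "char (density lborel (\<lambda>t. p t / c)) = char (density lborel (\<lambda>t. q t / c))"
        by (rule ext) (simp only: ch[OF ip pq(2)] ch[OF iq pq(3)] eq)
    qed
    then have "AE t in lborel. ennreal (p t / c) = ennreal (q t / c)"
      by (intro sigma_finite_measure.density_unique[OF sigma_finite_lborel]) auto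
    then show ?thesis
      by eventually_elim (use pq \<open>c > 0\<close> in \<open>auto simp: ennreal_inj\<close>)
  qed
  then show ?thesis by eventually_elim (simp add: pq)
qed

text \<open>
  Reduction to real functions: the conjugate of \<open>h\<close> also has vanishing transform, hence so do its real
  and imaginary parts.
\<close>

lemma fourier_unique:
  assumes h: "h \<in> L1" and zero: "\<And>x. fourier h x = 0"
  shows "AE t in lebesgue. h t = 0"
proof -
  obtain k where k: "k \<in> borel_measurable borel" "integrable lborel k" "k \<in> L1" "AE x in lebesgue. h x = k x"
    using L1_borel_representative[OF h] .
  note [measurable] = k(1)
  have z: "(\<integral>t. iexp (x * t) * k t \<partial>lborel) = 0" for x
    using zero[of x] fourier_cong_AE[OF h k(3,4)] fourier_lborel[OF k(1), of x] by (simp add: mult_ac)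
  have zc: "(\<integral>t. iexp (x * t) * cnj (k t) \<partial>lborel) = 0" for x
  proof -
    have "(\<integral>t. iexp (x * t) * cnj (k t) \<partial>lborel) = (\<integral>t. cnj (iexp (- x * t) * k t) \<partial>lborel)"
      by (intro Bochner_Integration.integral_cong refl) (simp add: exp_cnj)
    also have "\<dots> = cnj (\<integral>t. iexp (- x * t) * k t \<partial>lborel)" by (rule Bochner_Integration.integral_cnj)
    finally show ?thesis using z[of "-x"] by simp
  qed
  have ie: "integrable lborel (\<lambda>t. iexp (x * t) * f t)" if "integrable lborel f" for f x
    using that by (rule Bochner_Integration.integrable_bound) (use that in \<open>auto simp: norm_mult\<close>)
  have ik: "integrable lborel (\<lambda>t. cnj (k t))" using k(2) by simp
  have "AE t in lborel. Re (k t) = 0"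
  proof (rule real_fourier_unique)
    fix x
    have "(\<integral>t. iexp (x * t) * of_real (Re (k t)) \<partial>lborel)
        = (\<integral>t. (1/2) * (iexp (x * t) * k t + iexp (x * t) * cnj (k t)) \<partial>lborel)"
      by (intro Bochner_Integration.integral_cong refl) (simp add: complex_add_cnj flip: distrib_left)
    also have "\<dots> = 0" using z[of x] zc[of x] ie[OF k(2), of x] ie[OF ik, of x] by simp
    finally show "(\<integral>t. iexp (x * t) * of_real (Re (k t)) \<partial>lborel) = 0" .
  qed (use k in simp)
  moreover have "AE t in lborel. Im (k t) = 0"
  proof (rule real_fourier_unique)
    fix x
    have "(\<integral>t. iexp (x * t) * of_real (Im (k t)) \<partial>lborel)
        = (\<integral>t. (1/(2*\<i>)) * (iexp (x * t) * k t - iexp (x * t) * cnj (k t)) \<partial>lborel)"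
    proof (intro Bochner_Integration.integral_cong refl)
      fix t
      have "k t - cnj (k t) = 2 * \<i> * of_real (Im (k t))" by (simp add: complex_diff_cnj mult_ac)
      then have "(1/(2*\<i>)) * (iexp (x * t) * (k t - cnj (k t))) = iexp (x * t) * of_real (Im (k t))"
        by (simp only:) (simp add: field_simps)
      then show "iexp (x * t) * of_real (Im (k t)) = (1/(2*\<i>)) * (iexp (x * t) * k t - iexp (x * t) * cnj (k t))"
        by (simp only: right_diff_distrib)
    qed
    also have "\<dots> = 0" using z[of x] zc[of x] ie[OF k(2), of x] ie[OF ik, of x] by simp
    finally show "(\<integral>t. iexp (x * t) * of_real (Im (k t)) \<partial>lborel) = 0" .
  qed (use k in simp)
  ultimately have "AE t in lebesgue. k t = 0"
    unfolding AE_completion_iff by eventually_elim (simp add: complex_eq_iff)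
  with k(4) show ?thesis by eventually_elim simp
qed

lemma AE_scale_notin_null:
  fixes c :: real
  assumes "c \<noteq> 0" "N \<in> null_sets lborel"
  shows "AE t in lborel. c * t \<notin> N"
proof -
  have [measurable]: "N \<in> sets borel" using assms by auto
  have "(\<integral>\<^sup>+t. indicator N t \<partial>lborel) = \<bar>c\<bar> * (\<integral>\<^sup>+t. indicator N (0 + c * t) \<partial>lborel)"
    by (rule nn_integral_real_affine) (use assms in auto)
  moreover have "(\<integral>\<^sup>+t. indicator N t \<partial>lborel) = 0"
    using assms by (simp add: null_sets_def)
  ultimately have "(\<integral>\<^sup>+t. indicator N (c * t) \<partial>lborel) = 0" using assms(1) by simp
  then have "AE t in lborel. (indicator N (c * t) :: ennreal) = 0"
    by (subst (asm) nn_integral_0_iff_AE) auto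
  then show ?thesis by eventually_elim (auto split: split_indicator_asm)
qed

context prob_space
begin

text \<open>
  Fubini's theorem and the substitution \<open>u = L \<omega> * t\<close>. The factor \<open>\<bar>L \<omega>\<bar>\<close> is its Jacobian, so that
  every section has the \<open>L\<^sup>1\<close> norm of \<open>k\<close>; this makes the double integral absolutely convergent.
\<close>

lemma fourier_transfer_operator:
  fixes k :: "real \<Rightarrow> complex"
  assumes L [measurable]: "L \<in> borel_measurable M" and L0: "AE \<omega> in M. L \<omega> \<noteq> 0"
    and k [measurable]: "k \<in> borel_measurable borel" and int: "integrable lborel k"
  defines "T \<equiv> \<lambda>t. \<integral>\<omega>. of_real \<bar>L \<omega>\<bar> * k (L \<omega> * t) \<partial>M"
  shows "T \<in> L1" "fourier T x = (\<integral>\<omega>. fourier k (x / L \<omega>) \<partial>M)"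
proof -
  interpret P: pair_sigma_finite M lborel ..
  define G where "G x \<omega> t = exp (\<i> * of_real t * of_real x) * (of_real \<bar>L \<omega>\<bar> * k (L \<omega> * t))" for x \<omega> t
  have Gm [measurable]: "(\<lambda>(\<omega>, t). G x \<omega> t) \<in> borel_measurable (M \<Otimes>\<^sub>M lborel)" for x
    unfolding G_def by measurable
  have Gint: "integrable lborel (G x \<omega>)" if "L \<omega> \<noteq> 0" for x \<omega>
  proof -
    have i: "integrable lborel (\<lambda>t. of_real \<bar>L \<omega>\<bar> * k (L \<omega> * t))"
      using lborel_integrable_real_affine[OF int that, of 0] by simp
    show ?thesis
      unfolding G_def by (rule Bochner_Integration.integrable_bound[OF i])
        (auto simp: norm_mult norm_fourier_kernel)
  qed
  have GN: "(\<integral>t. norm (G x \<omega> t) \<partial>lborel) = (\<integral>t. norm (k t) \<partial>lborel)" if "L \<omega> \<noteq> 0" for x \<omega>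
    using lborel_integral_real_affine[OF that, of "\<lambda>t. norm (k t)" 0]
    by (simp add: G_def norm_mult norm_fourier_kernel)
  have Gprod: "integrable (M \<Otimes>\<^sub>M lborel) (\<lambda>(\<omega>, t). G x \<omega> t)" for x
  proof (rule P.Fubini_integrable)
    have "integrable M (\<lambda>\<omega>. \<integral>t. norm (k t) \<partial>lborel)" by simp
    then show "integrable M (\<lambda>\<omega>. \<integral>t. norm (case (\<omega>, t) of (\<omega>, t) \<Rightarrow> G x \<omega> t) \<partial>lborel)"
      by (rule integrable_cong_AE_imp) (use L0 in \<open>auto simp: GN elim!: eventually_mono\<close>)
    show "AE \<omega> in M. integrable lborel (\<lambda>t. case (\<omega>, t) of (\<omega>, t) \<Rightarrow> G x \<omega> t)"
      using L0 by eventually_elim (simp add: Gint)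
  qed measurable
  have T: "exp (\<i> * of_real t * of_real x) * T t = (\<integral>\<omega>. G x \<omega> t \<partial>M)" for x t
    unfolding T_def G_def by simp
  have Tint: "integrable lborel T"
    using P.integrable_snd[OF Gprod[of 0]] by (simp add: T[of _ 0, symmetric])
  then have Tm: "T \<in> borel_measurable borel" by auto
  show "T \<in> L1" using Tint Tm by (simp add: L1_def integrable_completion)
  have "fourier T x = (\<integral>t. \<integral>\<omega>. G x \<omega> t \<partial>M \<partial>lborel)"
    unfolding fourier_lborel[OF Tm] T ..
  also have "\<dots> = (\<integral>\<omega>. \<integral>t. G x \<omega> t \<partial>lborel \<partial>M)"
    by (rule P.Fubini_integral[OF Gprod])
  also have "\<dots> = (\<integral>\<omega>. fourier k (x / L \<omega>) \<partial>M)"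
  proof (rule integral_cong_AE)
    have "k \<in> L1" using int k by (simp add: L1_def integrable_completion)
    then have [measurable]: "fourier k \<in> borel_measurable borel" by (intro bounded_borel_measurable bounded_borel_fourier)
    show "(\<lambda>\<omega>. fourier k (x / L \<omega>)) \<in> borel_measurable M" by measurable
    show "AE \<omega> in M. (\<integral>t. G x \<omega> t \<partial>lborel) = fourier k (x / L \<omega>)"
      using L0
    proof eventually_elim
      case (elim \<omega>)
      have "fourier k (x / L \<omega>) = \<bar>L \<omega>\<bar> *\<^sub>R (\<integral>t. exp (\<i> * of_real (0 + L \<omega> * t) * of_real (x / L \<omega>)) * k (0 + L \<omega> * t) \<partial>lborel)"
        unfolding fourier_lborel[OF k] by (rule lborel_integral_real_affine[OF elim])
      also have "\<dots> = (\<integral>t. \<bar>L \<omega>\<bar> *\<^sub>R (exp (\<i> * of_real (0 + L \<omega> * t) * of_real (x / L \<omega>)) * k (0 + L \<omega> * t)) \<partial>lborel)"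
        by simp
      also have "\<dots> = (\<integral>t. G x \<omega> t \<partial>lborel)"
        using elim by (intro Bochner_Integration.integral_cong refl) (simp add: G_def scaleR_conv_of_real mult_ac)
      finally show ?case ..
    qed
  qed measurable
  finally show "fourier T x = (\<integral>\<omega>. fourier k (x / L \<omega>) \<partial>M)" .
qed

text \<open>
  For almost every \<open>t\<close>, almost all points \<open>L \<omega> * t\<close> avoid the null set where \<open>f\<close> and \<open>k\<close> differ: this holds
  for fixed \<open>\<omega>\<close> and almost every \<open>t\<close> by scaling, and Fubini's theorem exchanges the two quantifiers. The
  integrand with \<open>f\<close> is then measurable in \<open>\<omega>\<close> by completeness.
\<close>

lemma transfer_operator_representative:
  fixes k :: "real \<Rightarrow> complex"
  assumes "complete_measure M"
    and L [measurable]: "L \<in> borel_measurable M" and L0: "AE \<omega> in M. L \<omega> \<noteq> 0" and X0: "AE \<omega> in M. X \<omega> = 0"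
    and k [measurable]: "k \<in> borel_measurable borel" and eq: "AE x in lebesgue. f x = k x"
  shows "AE t in lebesgue. (\<integral>\<omega>. of_real \<bar>L \<omega>\<bar> * f (L \<omega> * t - X \<omega>) \<partial>M) = (\<integral>\<omega>. of_real \<bar>L \<omega>\<bar> * k (L \<omega> * t) \<partial>M)"
proof -
  interpret C: complete_measure M by fact
  interpret P: pair_sigma_finite M lborel ..
  obtain N where N: "N \<in> null_sets lborel" "\<And>x. x \<notin> N \<Longrightarrow> f x = k x"
    using eq unfolding AE_completion_iff by (auto elim!: AE_E3)
  have [measurable]: "N \<in> sets borel" using N by auto
  have "AE \<omega> in M. AE t in lborel. L \<omega> * t \<notin> N"
    using L0 by eventually_elim (rule AE_scale_notin_null[OF _ N(1)])
  then have "AE t in lborel. AE \<omega> in M. L \<omega> * t \<notin> N"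
    by (subst (asm) P.AE_commute) measurable
  then show ?thesis
    unfolding AE_completion_iff
  proof eventually_elim
    case (elim t)
    have ae: "AE \<omega> in M. of_real \<bar>L \<omega>\<bar> * f (L \<omega> * t - X \<omega>) = of_real \<bar>L \<omega>\<bar> * k (L \<omega> * t)"
      using elim X0 by eventually_elim (simp add: N(2))
    have m: "(\<lambda>\<omega>. of_real \<bar>L \<omega>\<bar> * k (L \<omega> * t)) \<in> borel_measurable M" by measurable
    show ?case
      by (rule integral_cong_AE[OF C.measurable_if_AE_eq[OF m ae] m ae]) simp
  qed
qed

end

section \<open>The functional equation on the Fourier side\<close>

context prob_space
begin

lemma I_int_eq_mavg_pow:
  assumes L [measurable]: "L \<in> borel_measurable M" and X [measurable]: "X \<in> borel_measurable M"
    and X0: "AE \<omega> in M. X \<omega> = 0" and h: "h \<in> L1"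
  shows "I_int M L X h n x = (mavg (inv_law L) ^^ n) (fourier h) x"
proof -
  have [measurable]: "fourier h \<in> borel_measurable borel" by (intro bounded_borel_measurable bounded_borel_fourier h)
  have prod_eq: "(\<Prod>j=1..n. coord L j w) = (\<Prod>j<n. L (w j))" for w
    using prod.atLeast1_atMost_eq[of "\<lambda>j. coord L j w" n] by (simp add: coord_def)
  have [measurable]: "coord Y j \<in> borel_measurable (countable_power M)"
    if [measurable]: "Y \<in> borel_measurable M" for Y j
    unfolding coord_def by measurable
  have "AE w in countable_power M. \<forall>i. X (w i) = 0"
    unfolding AE_all_countable using AE_coordinate[OF X0] by blast
  then have "AE w in countable_power M.
      exp (\<i> * of_real x * of_real (\<Sum>k=1..n. coord X k w / (\<Prod>j=1..k. coord L j w)))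
        * fourier h (x / (\<Prod>j=1..n. coord L j w)) = fourier h (x / (\<Prod>j<n. L (w j)))"
    by eventually_elim (simp only: prod_eq, simp add: coord_def)
  then show ?thesis
    unfolding I_int_def mavg_pow_inv_law[OF L bounded_borel_fourier[OF h]]
    by (intro integral_cong_AE) measurable
qed

lemma V_iff_fourier:
  assumes "complete_measure M"
    and L [measurable]: "L \<in> borel_measurable M" and L0: "AE \<omega> in M. L \<omega> \<noteq> 0" and X0: "AE \<omega> in M. X \<omega> = 0"
    and f: "f \<in> L1" and g: "g \<in> L1"
  shows "f \<in> V M L X g \<longleftrightarrow> (\<forall>x. fourier f x = mavg (inv_law L) (fourier f) x + fourier g x)"
proof -
  obtain k where k: "k \<in> borel_measurable borel" "integrable lborel k" "k \<in> L1" "AE x in lebesgue. f x = k x"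
    using L1_borel_representative[OF f] .
  define T where "T t = (\<integral>\<omega>. of_real \<bar>L \<omega>\<bar> * k (L \<omega> * t) \<partial>M)" for t
  have T: "T \<in> L1"
    unfolding T_def by (rule fourier_transfer_operator(1)[OF L L0 k(1,2)])
  have fT: "fourier T x = mavg (inv_law L) (fourier f) x" for x
    using fourier_transfer_operator(2)[OF L L0 k(1,2), of x] mavg_inv_law[OF L bounded_borel_fourier[OF f], of x]
    unfolding fourier_cong_AE[OF f k(3,4)] T_def by simp
  have Tg: "(\<lambda>t. T t + g t) \<in> L1" using T g by (simp add: L1_def)
  have Tg': "fourier (\<lambda>t. T t + g t) x = mavg (inv_law L) (fourier f) x + fourier g x" for x
    by (simp add: fourier_add[OF T g] fT)
  have rep: "AE t in lebesgue. (\<integral>\<omega>. of_real \<bar>L \<omega>\<bar> * f (L \<omega> * t - X \<omega>) \<partial>M) = T t"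
    unfolding T_def by (rule transfer_operator_representative[OF assms(1) L L0 X0 k(1,4)])
  have "f \<in> V M L X g \<longleftrightarrow> (AE t in lebesgue. f t = T t + g t)"
    unfolding V_def using f rep by (auto elim: eventually_elim2)
  also have "\<dots> \<longleftrightarrow> (\<forall>x. fourier f x = fourier (\<lambda>t. T t + g t) x)"
  proof
    assume "AE t in lebesgue. f t = T t + g t"
    then show "\<forall>x. fourier f x = fourier (\<lambda>t. T t + g t) x"
      using fourier_cong_AE[OF f Tg] by simp
  next
    assume "\<forall>x. fourier f x = fourier (\<lambda>t. T t + g t) x"
    then have "AE t in lebesgue. f t - (T t + g t) = 0"
      using f Tg by (intro fourier_unique) (simp_all only: fourier_diff, simp_all add: L1_def)
    then show "AE t in lebesgue. f t = T t + g t" by simp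
  qed
  finally show ?thesis unfolding Tg' .
qed

end

theorem theorem2p4:
  fixes P :: "'a measure" and L M :: "'a \<Rightarrow> real" and f g :: "real \<Rightarrow> complex"
  assumes "prob_space P" and "complete_measure P"
    and "L \<in> borel_measurable P" and "M \<in> borel_measurable P"
    and "measure P {\<omega> \<in> space P. L \<omega> = 0} = 0"
    and "g \<in> L1" and "\<not> (AE x in lebesgue. g x = 0)"
    and "f \<in> L1"
    and "measure P {\<omega> \<in> space P. M \<omega> = 0} = 1"
    and "integrable P (\<lambda>\<omega>. ln \<bar>L \<omega>\<bar>)" and "0 < (\<integral>\<omega>. ln \<bar>L \<omega>\<bar> \<partial>P)"
  shows "f \<in> V P L M g \<longleftrightarrow>
    (\<forall>x. summable (\<lambda>n. I_int P L M g (Suc n) x) \<and>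
         fourier f x = fourier f 0 + (\<Sum>n. I_int P L M g (Suc n) x) + fourier g x)"
proof -
  interpret P: prob_space P by fact
  note [measurable] = assms(3,4)
  interpret R: real_distribution "P.inv_law L" by (rule P.real_distribution_inv_law[OF assms(3)])
  define \<phi> \<gamma> where "\<phi> = fourier f" and "\<gamma> = fourier g"
  define U where "U = (mavg (P.inv_law L) :: (real \<Rightarrow> complex) \<Rightarrow> _)"
  have L0: "AE \<omega> in P. L \<omega> \<noteq> 0"
    using assms(5) by (subst (asm) P.prob_eq_0) (auto elim: eventually_mono)
  have M0: "AE \<omega> in P. M \<omega> = 0"
    using assms(9) by (subst (asm) P.prob_Collect_eq_1) auto
  have b: "bounded_borel \<phi>" "bounded_borel \<gamma>" unfolding \<phi>_def \<gamma>_def by (intro bounded_borel_fourier assms)+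
  have lim: "(\<lambda>n. (U ^^ n) \<phi> x) \<longlonglongrightarrow> \<phi> 0" for x
    unfolding U_def using b(1) isCont_fourier[OF assms(8), of 0] assms
    by (intro P.mavg_pow_tendsto) (auto simp: \<phi>_def)
  \<comment> \<open>Adding the term with \<open>n = 0\<close>, which is \<open>\<gamma> x\<close>, turns the stated identity into one geometric series in \<open>U\<close>.\<close>
  have series: "summable (\<lambda>n. I_int P L M g (Suc n) x) \<and>
         fourier f x = fourier f 0 + (\<Sum>n. I_int P L M g (Suc n) x) + fourier g x
      \<longleftrightarrow> (\<lambda>n. (U ^^ n) \<gamma> x) sums (\<phi> x - \<phi> 0)" for x
  proof -
    have I: "I_int P L M g (Suc n) x = (U ^^ Suc n) \<gamma> x" for n
      unfolding U_def \<gamma>_def by (rule P.I_int_eq_mavg_pow[OF assms(3,4) M0 assms(6)])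
    have "(\<lambda>n. (U ^^ n) \<gamma> x) sums (\<phi> x - \<phi> 0) \<longleftrightarrow> (\<lambda>n. (U ^^ Suc n) \<gamma> x) sums (\<phi> x - \<phi> 0 - \<gamma> x)"
      by (subst sums_Suc_iff) simp
    then show ?thesis
      unfolding I sums_iff \<phi>_def[symmetric] \<gamma>_def[symmetric] by (auto simp: algebra_simps)
  qed
  have "(\<forall>x. \<phi> x = U \<phi> x + \<gamma> x) \<longleftrightarrow> (\<forall>x. (\<lambda>n. (U ^^ n) \<gamma> x) sums (\<phi> x - \<phi> 0))"
  proof
    assume "\<forall>x. \<phi> x = U \<phi> x + \<gamma> x"
    then have "\<gamma> = defect (P.inv_law L) \<phi>"
      by (simp add: defect_def U_def fun_eq_iff)
    then have "(\<Sum>n<N. (U ^^ n) \<gamma> x) = \<phi> x - (U ^^ N) \<phi> x" for N x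
      using R.sum_mavg_pow_defect[OF b(1)] by (simp add: U_def)
    then show "\<forall>x. (\<lambda>n. (U ^^ n) \<gamma> x) sums (\<phi> x - \<phi> 0)"
      unfolding sums_def by (auto intro!: tendsto_intros lim)
  next
    assume sums: "\<forall>x. (\<lambda>n. (U ^^ n) \<gamma> x) sums (\<phi> x - \<phi> 0)"
    let ?\<psi> = "\<lambda>x. defect (P.inv_law L) \<phi> x - \<gamma> x"
    have "(\<lambda>N. \<Sum>n<N. (U ^^ n) ?\<psi> x) \<longlonglongrightarrow> 0" for x
    proof -
      have "(\<Sum>n<N. (U ^^ n) ?\<psi> x) = (\<phi> x - (U ^^ N) \<phi> x) - (\<Sum>n<N. (U ^^ n) \<gamma> x)" for N
        using R.mavg_pow_diff[OF R.bounded_borel_defect[OF b(1)] b(2)] R.sum_mavg_pow_defect[OF b(1)]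
        by (simp add: U_def sum_subtractf)
      moreover have "(\<lambda>N. (\<phi> x - (U ^^ N) \<phi> x) - (\<Sum>n<N. (U ^^ n) \<gamma> x)) \<longlonglongrightarrow> (\<phi> x - \<phi> 0) - (\<phi> x - \<phi> 0)"
        using sums unfolding sums_def by (intro tendsto_intros lim) auto
      ultimately show ?thesis by simp
    qed
    then have "?\<psi> x = 0" for x
      unfolding U_def by (intro R.potential_zero_imp_zero bounded_borel_diff R.bounded_borel_defect b)
    then show "\<forall>x. \<phi> x = U \<phi> x + \<gamma> x" by (simp add: defect_def U_def algebra_simps)
  qed
  then show ?thesis
    unfolding series P.V_iff_fourier[OF assms(2,3) L0 M0 assms(8,6)]
    unfolding \<phi>_def[symmetric] \<gamma>_def[symmetric] U_def[symmetric] .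
qed

end
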